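(* Let $X$ be a nonempty set, $\Sigma$ a lattice of subsets of $X$, $E$ a regularly ordered Banach space and $\boldsymbol{\mu}:\Sigma\rightarrow E_{+}$ a submodular vector capacity. Then the associated Choquet-Bochner integral is subadditive, that is, $$(\mathrm{CB})\int_{A}(f+g)\,\mathrm{d}\boldsymbol{\mu}\leq(\mathrm{CB})\int_{A}f\,\mathrm{d}\boldsymbol{\mu}+(\mathrm{CB})\int_{A}g\,\mathrm{d}\boldsymbol{\mu}$$ whenever $f$, $g$ and $f+g$ are Choquet-Bochner integrable functions and $A\in\Sigma$. In addition, when $E$ is a Banach lattice and $f$, $g$, $f-g$ and $g-f$ are Choquet-Bochner integrable functions, then $$\left\vert(\mathrm{CB})\int_{A}f\,\mathrm{d}\boldsymbol{\mu}-(\mathrm{CB})\int_{A}g\,\mathrm{d}\boldsymbol{\mu}\right\vert\leq(\mathrm{CB})\int_{A}|f-g|\,\mathrm{d}\boldsymbol{\mu}$$ for all $A\in\Sigma$. In particular, $$\left\vert(\mathrm{CB})\int_{A}f\,\mathrm{d}\boldsymbol{\mu}\right\vert\leq(\mathrm{CB})\int_{A}|f|\,\mathrm{d}\boldsymbol{\mu}$$ whenever $f$ and $-f$ are Choquet-Bochner integrable functions and $A\in\Sigma$.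
   Context: An ordered Banach space is a real Banach space $E$ with a compatible vector order whose positive cone $E_{+}=\{x\in E:x\geq0\}$ is norm-closed, proper ($E_+\cap(-E_+)=\{0\}$) and generating ($E=E_{+}-E_{+}$), and such that $0\leq x\leq y$ implies $\Vert x\Vert\leq\Vert y\Vert$. It is regularly ordered if $\Vert x\Vert=\inf\{\Vert y\Vert:y\in E,\ -y\leq x\leq y\}$ for all $x\in E$. Banach lattices are regularly ordered Banach spaces; in a Banach lattice $|x|=\sup\{x,-x\}$. A lattice of subsets of $X$ is a collection $\Sigma$ of subsets containing $\emptyset$ and $X$ and closed under finite unions and intersections. A vector capacity is a set function $\boldsymbol{\mu}:\Sigma\to E_+$ with $\boldsymbol{\mu}(\emptyset)=0$ and $\boldsymbol{\mu}(A)\leq\boldsymbol{\mu}(B)$ whenever $A\subset B$ in $\Sigma$. It is submodular if $\boldsymbol{\mu}(A\cup B)+\boldsymbol{\mu}(A\cap B)\leq\boldsymbol{\mu}(A)+\boldsymbol{\mu}(B)$ for all $A,B\in\Sigma$. A function $f:X\to\mathbb{R}$ is measurable if $\{x\in X:f(x)\geq t\}\in\Sigma$ for all $t\in\mathbb{R}$. A measurable $f$ is Choquet-Bochner integrable (with respect to $\boldsymbol{\mu}$) if for every $A\in\Sigma$ the functions $t\mapsto\boldsymbol{\mu}(\{x\in A:f(x)\geq t\})$ and $t\mapsto\boldsymbol{\mu}(\{x\in A:f(x)\geq t\})-\boldsymbol{\mu}(A)$ are Bochner integrable (Lebesgue measure) on $[0,\infty)$ and $(-\infty,0]$ respectively.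 Under these circumstances its Choquet-Bochner integral over $A$ is defined as $$(\mathrm{CB})\int_{A}f\,\mathrm{d}\boldsymbol{\mu}=\int_{0}^{+\infty}\boldsymbol{\mu}(\{x\in A:f(x)\geq t\})\,\mathrm{d}t+\int_{-\infty}^{0}\left[\boldsymbol{\mu}(\{x\in A:f(x)\geq t\})-\boldsymbol{\mu}(A)\right]\mathrm{d}t .$$ *)

theory Defs
  imports "HOL-Analysis.Analysis"
begin

section \<open>Ordered Banach spaces\<close>

text \<open>Properness of the positive cone is antisymmetry of the order.\<close>

class ordered_banach = banach + ordered_real_vector +
  assumes closed_positive_cone: "closed {x. 0 \<le> x}"
    and positive_cone_generating: "\<exists>y z. 0 \<le> y \<and> 0 \<le> z \<and> x = y - z"
    and norm_mono_positive: "0 \<le> x \<Longrightarrow> x \<le> y \<Longrightarrow> norm x \<le> norm y"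

class regularly_ordered_banach = ordered_banach +
  assumes norm_regular: "norm x = Inf {norm y | y. - y \<le> x \<and> x \<le> y}"

instance real :: regularly_ordered_banach
proof
  show "closed {x::real. 0 \<le> x}"
    by (simp add: closed_Collect_le)
  fix x y :: real
  show "\<exists>y z. 0 \<le> y \<and> 0 \<le> z \<and> x = y - z"
    by (rule exI[of _ "max x 0"], rule exI[of _ "max (- x) 0"]) auto
  show "0 \<le> x \<Longrightarrow> x \<le> y \<Longrightarrow> norm x \<le> norm y"
    by simp
  show "norm x = Inf {norm y | y. - y \<le> x \<and> x \<le> y}"
    by (rule cInf_eq_minimum[symmetric]) (auto intro!: exI[of _ "\<bar>x\<bar>"])
qed

text \<open>The modulus is the least upper bound of \<open>x\<close> and \<open>- x\<close>; it is only meaningful if that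
  least upper bound exists, as it does whenever the predicate \<open>banach_lattice\<close> below holds.\<close>

definition modulus :: "'e::{order, uminus} \<Rightarrow> 'e" where
  "modulus x = (LEAST u. x \<le> u \<and> - x \<le> u)"

definition vector_lattice :: "'e::ordered_real_vector itself \<Rightarrow> bool" where
  "vector_lattice _ \<longleftrightarrow>
    (\<forall>x y :: 'e. (\<exists>s. x \<le> s \<and> y \<le> s \<and> (\<forall>u. x \<le> u \<and> y \<le> u \<longrightarrow> s \<le> u)) \<and>
                 (\<exists>i. i \<le> x \<and> i \<le> y \<and> (\<forall>l. l \<le> x \<and> l \<le> y \<longrightarrow> l \<le> i)))"

definition banach_lattice :: "'e::{banach, ordered_real_vector} itself \<Rightarrow> bool" where
  "banach_lattice _ \<longleftrightarrow> vector_lattice TYPE('e) \<and>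
    (\<forall>x y :: 'e. modulus x \<le> modulus y \<longrightarrow> norm x \<le> norm y)"


section \<open>The Bochner integral in arbitrary Banach spaces\<close>

text \<open>The library's \<^const>\<open>has_bochner_integral\<close> requires a second countable, that is, separable
  target space. The version below replaces Borel measurability by strong measurability (almost
  everywhere approximability by simple functions), so that no separability is needed.\<close>

definition strongly_measurable :: "'a measure \<Rightarrow> ('a \<Rightarrow> 'e::real_normed_vector) \<Rightarrow> bool" where
  "strongly_measurable M f \<longleftrightarrow>
    (\<exists>s. (\<forall>i. simple_function M (s i)) \<and> (AE x in M. (\<lambda>i. s i x) \<longlonglongrightarrow> f x))"

definition has_strong_integral ::
  "'a measure \<Rightarrow> ('a \<Rightarrow> 'e::real_normed_vector) \<Rightarrow> 'e \<Rightarrow> bool" where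
  "has_strong_integral M f v \<longleftrightarrow> strongly_measurable M f \<and>
    (\<exists>s. (\<forall>i. Bochner_Integration.simple_bochner_integrable M (s i)) \<and>
         (\<lambda>i. \<integral>\<^sup>+x. ennreal (norm (f x - s i x)) \<partial>M) \<longlonglongrightarrow> 0 \<and>
         (\<lambda>i. Bochner_Integration.simple_bochner_integral M (s i)) \<longlonglongrightarrow> v)"

definition strongly_integrable :: "'a measure \<Rightarrow> ('a \<Rightarrow> 'e::real_normed_vector) \<Rightarrow> bool" where
  "strongly_integrable M f \<longleftrightarrow> (\<exists>v. has_strong_integral M f v)"

definition strong_integral :: "'a measure \<Rightarrow> ('a \<Rightarrow> 'e::real_normed_vector) \<Rightarrow> 'e" where
  "strong_integral M f = (THE v. has_strong_integral M f v)"

text \<open>For separable targets and complete measures this is the library's integral.\<close>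

lemma has_bochner_integral_imp_has_strong_integral:
  fixes f :: "'a \<Rightarrow> 'e::{real_normed_vector, second_countable_topology}"
  assumes "has_bochner_integral M f v"
  shows "has_strong_integral M f v"
proof -
  from assms obtain s where f: "f \<in> borel_measurable M"
    and s: "\<And>i. Bochner_Integration.simple_bochner_integrable M (s i)"
      "(\<lambda>i. \<integral>\<^sup>+x. norm (f x - s i x) \<partial>M) \<longlonglongrightarrow> 0"
      "(\<lambda>i. Bochner_Integration.simple_bochner_integral M (s i)) \<longlonglongrightarrow> v"
    by (rule has_bochner_integral.cases) blast
  from borel_measurable_implies_sequence_metric[OF f, of 0]
  have "strongly_measurable M f"
    unfolding strongly_measurable_def by blast
  with s show ?thesis
    unfolding has_strong_integral_def by blast
qed

lemma has_strong_integral_imp_has_bochner_integral: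
  fixes f :: "'a \<Rightarrow> 'e::{real_normed_vector, second_countable_topology}"
  assumes "complete_measure M" "has_strong_integral M f v"
  shows "has_bochner_integral M f v"
proof -
  interpret complete_measure M by fact
  from assms(2) obtain s r where s: "\<And>i. Bochner_Integration.simple_bochner_integrable M (s i)"
      "(\<lambda>i. \<integral>\<^sup>+x. norm (f x - s i x) \<partial>M) \<longlonglongrightarrow> 0"
      "(\<lambda>i. Bochner_Integration.simple_bochner_integral M (s i)) \<longlonglongrightarrow> v"
    and r: "\<And>i. simple_function M (r i)" "AE x in M. (\<lambda>i. r i x) \<longlonglongrightarrow> f x"
    unfolding has_strong_integral_def strongly_measurable_def by blast
  have [measurable]: "r i \<in> borel_measurable M" for i
    using r(1) by (rule borel_measurable_simple_function)
  obtain N where N: "N \<in> null_sets M" "{x \<in> space M. \<not> (\<lambda>i. r i x) \<longlonglongrightarrow> f x} \<subseteq> N"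
    using r(2) by (auto elim!: AE_E simp: null_sets_def)
  define g where "g x = (if x \<in> N then 0 else f x)" for x
  have [measurable]: "N \<in> sets M"
    using N by auto
  have g: "g \<in> borel_measurable M"
  proof (rule borel_measurable_LIMSEQ_metric)
    show "(\<lambda>x. if x \<in> N then 0 else r i x) \<in> borel_measurable M" for i
      by measurable
    show "(\<lambda>i. if x \<in> N then 0 else r i x) \<longlonglongrightarrow> g x" if "x \<in> space M" for x
      using N that by (auto simp: g_def)
  qed
  have "f \<in> borel_measurable M"
  proof (rule measurableI)
    fix S :: "'e set" assume [measurable]: "S \<in> sets borel"
    have "f -` S \<inter> space M = (g -` S \<inter> space M - N) \<union> (f -` S \<inter> space M \<inter> N)"
      by (auto simp: g_def)
    moreover have "g -` S \<inter> space M - N \<in> sets M"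
      using g by measurable
    moreover have "f -` S \<inter> space M \<inter> N \<in> sets M"
      using complete[of "f -` S \<inter> space M \<inter> N" N] N(1) by blast
    ultimately show "f -` S \<inter> space M \<in> sets M"
      by (metis sets.Un)
  qed simp
  then show ?thesis
    using s by (rule has_bochner_integral.intros)
qed


section \<open>Vector capacities and the Choquet-Bochner integral\<close>

definition lattice_of_sets :: "'x set \<Rightarrow> 'x set set \<Rightarrow> bool" where
  "lattice_of_sets X \<Sigma> \<longleftrightarrow> \<Sigma> \<subseteq> Pow X \<and> {} \<in> \<Sigma> \<and> X \<in> \<Sigma> \<and>
    (\<forall>A\<in>\<Sigma>. \<forall>B\<in>\<Sigma>. A \<union> B \<in> \<Sigma> \<and> A \<inter> B \<in> \<Sigma>)"

definition vector_capacity :: "'x set set \<Rightarrow> ('x set \<Rightarrow> 'e::ordered_banach) \<Rightarrow> bool" where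
  "vector_capacity \<Sigma> \<mu> \<longleftrightarrow> (\<forall>A\<in>\<Sigma>. 0 \<le> \<mu> A) \<and> \<mu> {} = 0 \<and>
    (\<forall>A\<in>\<Sigma>. \<forall>B\<in>\<Sigma>. A \<subseteq> B \<longrightarrow> \<mu> A \<le> \<mu> B)"

definition submodular :: "'x set set \<Rightarrow> ('x set \<Rightarrow> 'e::ordered_banach) \<Rightarrow> bool" where
  "submodular \<Sigma> \<mu> \<longleftrightarrow> (\<forall>A\<in>\<Sigma>. \<forall>B\<in>\<Sigma>. \<mu> (A \<union> B) + \<mu> (A \<inter> B) \<le> \<mu> A + \<mu> B)"

definition lattice_measurable :: "'x set \<Rightarrow> 'x set set \<Rightarrow> ('x \<Rightarrow> real) \<Rightarrow> bool" where
  "lattice_measurable X \<Sigma> f \<longleftrightarrow> (\<forall>t. {x \<in> X. f x \<ge> t} \<in> \<Sigma>)"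

definition CB_integrable ::
  "'x set \<Rightarrow> 'x set set \<Rightarrow> ('x set \<Rightarrow> 'e::ordered_banach) \<Rightarrow> ('x \<Rightarrow> real) \<Rightarrow> bool" where
  "CB_integrable X \<Sigma> \<mu> f \<longleftrightarrow> lattice_measurable X \<Sigma> f \<and>
    (\<forall>A\<in>\<Sigma>.
      strongly_integrable (lebesgue_on {0..}) (\<lambda>t. \<mu> {x \<in> A. f x \<ge> t}) \<and>
      strongly_integrable (lebesgue_on {..0}) (\<lambda>t. \<mu> {x \<in> A. f x \<ge> t} - \<mu> A))"

definition CB_integral :: "('x set \<Rightarrow> 'e::ordered_banach) \<Rightarrow> 'x set \<Rightarrow> ('x \<Rightarrow> real) \<Rightarrow> 'e" where
  "CB_integral \<mu> A f =
    strong_integral (lebesgue_on {0..}) (\<lambda>t. \<mu> {x \<in> A. f x \<ge> t}) +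
    strong_integral (lebesgue_on {..0}) (\<lambda>t. \<mu> {x \<in> A. f x \<ge> t} - \<mu> A)"

end

theory Submission
  imports Defs "HOL-Real_Asymp.Real_Asymp"
begin

text \<open>Subadditivity is first proved for the integer-valued functions obtained by rounding \<open>f / h\<close> and
  \<open>g / h\<close>, whose integrals are finite sums of capacities of level sets: adding one indicator at a
  time, submodularity produces a telescoping sum. As \<open>t \<mapsto> \<mu> {x \<in> A. f x \<ge> t}\<close> is decreasing, these
  sums are Riemann sums that bound the integrals in order, and refining them gives the inequality
  since the cone is closed. No functionals are needed: order is preserved by the Bochner integral
  because the simple functions approximating a cone-valued function can be moved into the cone.

  For the modulus, submodularity yields, for \<open>s \<le> t\<close>, that the increment of
  \<open>t \<mapsto> \<mu> {\<bar>f\<bar> \<ge> t}\<close> is dominated by that of \<open>t \<mapsto> \<mu> {f \<ge> t} + \<mu> {- f \<ge> t}\<close>. The former is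
  therefore a nonexpansive function of the latter, which makes it strongly integrable.\<close>


section \<open>Strong measurability and the strong integral\<close>

text \<open>The obstacle is that \<open>'e\<close> may be nonseparable, where monotone maps can fail
  to be strongly measurable: in L-infinity of [0,1] the indicators of [0,t] increase with t but lie
  at pairwise distance 1. So the integrability of the level function of |f| cannot be read off from
  its monotonicity and has to be transported from f and - f. The norm, being monotone on the cone,
  turns the order estimate for increments into the norm estimate that makes one level function a
  nonexpansive image of the other. The extension of such an image serves twice: between two
  different functions for |f|, and between a function and itself for positivity. Rounding comes
  before submodularity because a lattice of sets offers only finite unions and intersections. Level
  sets of a sum of bounded integer-valued functions are built from finitely many of these.\<close>

lemma strongly_measurable_simple:
  "simple_function M s \<Longrightarrow> strongly_measurable M s"
  unfolding strongly_measurable_def by (intro exI[of _ "\<lambda>_. s"]) auto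

lemma strongly_measurable_add:
  assumes "strongly_measurable M f" "strongly_measurable M g"
  shows "strongly_measurable M (\<lambda>x. f x + g x)"
proof -
  obtain s where s: "\<And>i. simple_function M (s i)" "AE x in M. (\<lambda>i. s i x) \<longlonglongrightarrow> f x"
    using assms(1) unfolding strongly_measurable_def by blast
  obtain r where r: "\<And>i. simple_function M (r i)" "AE x in M. (\<lambda>i. r i x) \<longlonglongrightarrow> g x"
    using assms(2) unfolding strongly_measurable_def by blast
  show ?thesis
    unfolding strongly_measurable_def
  proof (intro exI[of _ "\<lambda>i x. s i x + r i x"] conjI allI)
    show "simple_function M (\<lambda>x. s i x + r i x)" for i
      using s(1) r(1) by (rule simple_function_compose2)
    show "AE x in M. (\<lambda>i. s i x + r i x) \<longlonglongrightarrow> f x + g x"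
      using s(2) r(2) by eventually_elim (rule tendsto_add)
  qed
qed

lemma strongly_measurable_scaleR:
  fixes f :: "'a \<Rightarrow> 'e::real_normed_vector"
  assumes "simple_function M (u :: 'a \<Rightarrow> real)" "strongly_measurable M f"
  shows "strongly_measurable M (\<lambda>x. u x *\<^sub>R f x)"
proof -
  obtain s where s: "\<And>i. simple_function M (s i)" "AE x in M. (\<lambda>i. s i x) \<longlonglongrightarrow> f x"
    using assms unfolding strongly_measurable_def by blast
  show ?thesis
    unfolding strongly_measurable_def
  proof (intro exI[of _ "\<lambda>i x. u x *\<^sub>R s i x"] conjI allI)
    show "simple_function M (\<lambda>x. u x *\<^sub>R s i x)" for i
      using assms(1) s(1) by (rule simple_function_compose2)
    show "AE x in M. (\<lambda>i. u x *\<^sub>R s i x) \<longlonglongrightarrow> u x *\<^sub>R f x"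
      using s(2) by eventually_elim (intro tendsto_intros)
  qed
qed

lemma strongly_measurable_diff:
  fixes f :: "'a \<Rightarrow> 'e::real_normed_vector"
  assumes "strongly_measurable M f" "strongly_measurable M g"
  shows "strongly_measurable M (\<lambda>x. f x - g x)"
  using strongly_measurable_add[OF assms(1)
      strongly_measurable_scaleR[OF simple_function_const assms(2), of "- 1"]] by simp

lemma strongly_measurable_cong_AE:
  assumes "strongly_measurable M f" "AE x in M. f x = g x"
  shows "strongly_measurable M g"
proof -
  obtain s where s: "\<And>i. simple_function M (s i)" "AE x in M. (\<lambda>i. s i x) \<longlonglongrightarrow> f x"
    using assms unfolding strongly_measurable_def by blast
  have "AE x in M. (\<lambda>i. s i x) \<longlonglongrightarrow> g x"
    using s(2) assms(2) by eventually_elim simp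
  with s(1) show ?thesis
    unfolding strongly_measurable_def by blast
qed

text \<open>On an incomplete measure space the norm of a strongly measurable function is measurable
  only up to a null set, so a measurable version is provided. The limit of the norms of the
  approximants is one; its value where they diverge is irrelevant almost everywhere.\<close>

lemma strongly_measurable_norm:
  fixes f :: "'a \<Rightarrow> 'e::real_normed_vector"
  assumes "strongly_measurable M f"
  obtains g :: "'a \<Rightarrow> ennreal" where "g \<in> borel_measurable M" "AE x in M. ennreal (norm (f x)) = g x"
proof -
  obtain s where s: "\<And>i. simple_function M (s i)" "AE x in M. (\<lambda>i. s i x) \<longlonglongrightarrow> f x"
    using assms unfolding strongly_measurable_def by blast
  define g where "g x = lim (\<lambda>i. ennreal (norm (s i x)))" for x
  have "(\<lambda>x. ennreal (norm (s i x))) \<in> borel_measurable M" for i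
    by (rule borel_measurable_simple_function[OF simple_function_compose1[OF s(1), of "\<lambda>y. ennreal (norm y)"]])
  then have "g \<in> borel_measurable M"
    unfolding g_def by (rule borel_measurable_lim)
  moreover have "AE x in M. ennreal (norm (f x)) = g x"
    using s(2)
  proof eventually_elim
    case (elim x)
    then have "(\<lambda>i. ennreal (norm (s i x))) \<longlonglongrightarrow> ennreal (norm (f x))"
      by (intro tendsto_ennrealI tendsto_norm)
    then show ?case
      unfolding g_def by (rule limI[symmetric])
  qed
  ultimately show ?thesis
    by (rule that)
qed

text \<open>The nonnegative integral is a supremum over simple functions from below, so its
  subadditivity depends on measurable summands. The sum is therefore split for the measurable
  versions \<open>f'\<close> and \<open>g'\<close>.\<close>

lemma nn_integral_norm_triangle:
  fixes f g :: "'a \<Rightarrow> 'e::real_normed_vector"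
  assumes "strongly_measurable M f" "strongly_measurable M g"
    and le: "\<And>x. x \<in> space M \<Longrightarrow> norm (k x) \<le> norm (f x) + norm (g x)"
  shows "(\<integral>\<^sup>+x. ennreal (norm (k x)) \<partial>M)
    \<le> (\<integral>\<^sup>+x. ennreal (norm (f x)) \<partial>M) + (\<integral>\<^sup>+x. ennreal (norm (g x)) \<partial>M)"
proof -
  obtain f' :: "'a \<Rightarrow> ennreal" where f': "f' \<in> borel_measurable M" "AE x in M. ennreal (norm (f x)) = f' x"
    using strongly_measurable_norm[OF assms(1)] .
  obtain g' :: "'a \<Rightarrow> ennreal" where g': "g' \<in> borel_measurable M" "AE x in M. ennreal (norm (g x)) = g' x"
    using strongly_measurable_norm[OF assms(2)] .
  have "(\<integral>\<^sup>+x. ennreal (norm (k x)) \<partial>M) \<le> (\<integral>\<^sup>+x. f' x + g' x \<partial>M)"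
  proof (rule nn_integral_mono_AE)
    show "AE x in M. ennreal (norm (k x)) \<le> f' x + g' x"
      using f'(2) g'(2) AE_space
    proof eventually_elim
      case (elim x)
      show ?case
        using le[OF elim(3)] by (simp flip: elim(1,2) add: ennreal_leI flip: ennreal_plus)
    qed
  qed
  also have "\<dots> = (\<integral>\<^sup>+x. f' x \<partial>M) + (\<integral>\<^sup>+x. g' x \<partial>M)"
    using f'(1) g'(1) by (rule nn_integral_add)
  also have "(\<integral>\<^sup>+x. f' x \<partial>M) = (\<integral>\<^sup>+x. ennreal (norm (f x)) \<partial>M)"
    using f'(2) by (intro nn_integral_cong_AE) auto
  also have "(\<integral>\<^sup>+x. g' x \<partial>M) = (\<integral>\<^sup>+x. ennreal (norm (g x)) \<partial>M)"
    using g'(2) by (intro nn_integral_cong_AE) auto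
  finally show ?thesis .
qed

lemma norm_simple_bochner_integral_le:
  assumes "Bochner_Integration.simple_bochner_integrable M s"
  shows "ennreal (norm (Bochner_Integration.simple_bochner_integral M s))
    \<le> (\<integral>\<^sup>+x. ennreal (norm (s x)) \<partial>M)"
proof -
  have "ennreal (norm (Bochner_Integration.simple_bochner_integral M s))
    \<le> ennreal (Bochner_Integration.simple_bochner_integral M (\<lambda>x. norm (s x)))"
    using assms by (intro ennreal_leI simple_bochner_integral_norm_bound)
  also have "\<dots> = (\<integral>\<^sup>+x. ennreal (norm (s x)) \<partial>M)"
    using simple_bochner_integrable_compose2[of "\<lambda>x _. norm x" M s s] assms
    by (intro simple_bochner_integral_eq_nn_integral) auto
  finally show ?thesis .
qed

lemma simple_bochner_integrableD:
  "Bochner_Integration.simple_bochner_integrable M s \<Longrightarrow> simple_function M s"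
  by (auto elim: simple_bochner_integrable.cases)

text \<open>In a complete space the convergence of the simple integrals is automatic: two of them
  differ by at most the sum of the mean distances of the approximants to \<open>f\<close>, so they
  form a Cauchy sequence.\<close>

lemma strongly_integrableI:
  fixes f :: "'a \<Rightarrow> 'e::banach"
  assumes f: "strongly_measurable M f"
    and s: "\<And>i. Bochner_Integration.simple_bochner_integrable M (s i)"
    and lim: "(\<lambda>i. \<integral>\<^sup>+x. ennreal (norm (f x - s i x)) \<partial>M) \<longlonglongrightarrow> 0"
  obtains v where "(\<lambda>i. Bochner_Integration.simple_bochner_integral M (s i)) \<longlonglongrightarrow> v"
    "has_strong_integral M f v"
proof -
  let ?I = "\<lambda>i. Bochner_Integration.simple_bochner_integral M (s i)"
  let ?e = "\<lambda>i. \<integral>\<^sup>+x. ennreal (norm (f x - s i x)) \<partial>M"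
  have m: "strongly_measurable M (\<lambda>x. f x - s i x)" for i
    using f strongly_measurable_simple[OF simple_bochner_integrableD[OF s]]
    by (rule strongly_measurable_diff)
  have le: "ennreal (norm (?I i - ?I j)) \<le> ?e i + ?e j" for i j
  proof -
    have "ennreal (norm (?I i - ?I j))
      = ennreal (norm (Bochner_Integration.simple_bochner_integral M (\<lambda>x. s i x - s j x)))"
      by (simp add: simple_bochner_integral_diff[OF s s])
    also have "\<dots> \<le> (\<integral>\<^sup>+x. ennreal (norm (s i x - s j x)) \<partial>M)"
      by (intro norm_simple_bochner_integral_le simple_bochner_integrable_compose2[of "(-)", OF _ s s]) simp
    also have "\<dots> \<le> ?e i + ?e j"
      by (rule nn_integral_norm_triangle[OF m m]) norm
    finally show ?thesis .
  qed
  have "Cauchy ?I"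
  proof (rule metric_CauchyI)
    fix e :: real assume "0 < e"
    then have "\<forall>\<^sub>F i in sequentially. ?e i < ennreal (e / 2)"
      by (intro order_tendstoD(2)[OF lim]) auto
    then obtain N where N: "?e i < ennreal (e / 2)" if "N \<le> i" for i
      unfolding eventually_sequentially by blast
    have "dist (?I i) (?I j) < e" if "N \<le> i" "N \<le> j" for i j
    proof -
      have "ennreal (norm (?I i - ?I j)) < ennreal (e / 2) + ennreal (e / 2)"
        using le[of i j] N that by (meson add_strict_mono order.strict_trans1)
      also have "\<dots> = ennreal e"
        using \<open>0 < e\<close> by (simp flip: ennreal_plus)
      finally show ?thesis
        using \<open>0 < e\<close> by (simp add: dist_norm ennreal_less_iff)
    qed
    then show "\<exists>N. \<forall>m\<ge>N. \<forall>n\<ge>N. dist (?I m) (?I n) < e"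
      by blast
  qed
  then obtain v where v: "?I \<longlonglongrightarrow> v"
    using Cauchy_convergent convergentD by blast
  with f s lim have "has_strong_integral M f v"
    unfolding has_strong_integral_def by (intro conjI exI[of _ s]) auto
  with v show ?thesis
    by (rule that)
qed

lemma has_strong_integral_measurable:
  "has_strong_integral M f v \<Longrightarrow> strongly_measurable M f"
  by (simp add: has_strong_integral_def)

lemma has_strong_integral_cong_AE:
  assumes "has_strong_integral M f v" "AE x in M. f x = g x"
  shows "has_strong_integral M g v"
proof -
  have "(\<integral>\<^sup>+x. ennreal (norm (g x - s x)) \<partial>M) = (\<integral>\<^sup>+x. ennreal (norm (f x - s x)) \<partial>M)" for s
    by (rule nn_integral_cong_AE, rule eventually_mono[OF assms(2)]) simp
  moreover have "strongly_measurable M g"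
    using has_strong_integral_measurable[OF assms(1)] assms(2) by (rule strongly_measurable_cong_AE)
  ultimately show ?thesis
    using assms(1) by (simp add: has_strong_integral_def)
qed

section \<open>Simple integrands and linearity\<close>

lemma has_strong_integral_simple:
  assumes "Bochner_Integration.simple_bochner_integrable M s"
  shows "has_strong_integral M s (Bochner_Integration.simple_bochner_integral M s)"
  unfolding has_strong_integral_def
  using assms strongly_measurable_simple[OF simple_bochner_integrableD[OF assms]]
  by (intro conjI exI[of _ "\<lambda>_. s"] allI) simp_all

lemma has_strong_integral_indicator:
  assumes "A \<in> sets M" "emeasure M A < \<infinity>"
  shows "has_strong_integral M (\<lambda>x. indicator A x *\<^sub>R c) (measure M A *\<^sub>R c)"
proof -
  let ?s = "indicator A :: 'a \<Rightarrow> real"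
  have s: "Bochner_Integration.simple_bochner_integrable M ?s"
  proof
    have "{y \<in> space M. ?s y \<noteq> 0} = A"
      using sets.sets_into_space[OF assms(1)] by (auto split: split_indicator)
    with assms(2) show "emeasure M {y \<in> space M. ?s y \<noteq> 0} \<noteq> \<infinity>"
      by auto
  qed (use assms(1) in auto)
  have "has_bochner_integral M ?s (measure M A)"
    using assms by (rule has_bochner_integral_real_indicator)
  with has_bochner_integral_simple_bochner_integrable[OF s]
  have I: "Bochner_Integration.simple_bochner_integral M ?s = measure M A"
    by (rule has_bochner_integral_eq)
  \<comment> \<open>The real-valued indicator has a known integral; the linear map into the line
    spanned by \<open>c\<close> carries it over to \<open>'e\<close>.\<close>
  have "linear (\<lambda>t::real. t *\<^sub>R c)"
    by (rule linear_scaleR_left)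
  then have "Bochner_Integration.simple_bochner_integral M (\<lambda>x. ?s x *\<^sub>R c) = measure M A *\<^sub>R c"
    using simple_bochner_integral_linear[OF _ s] I by fastforce
  with has_strong_integral_simple[OF simple_bochner_integrable_compose2[of "\<lambda>t _. t *\<^sub>R c", OF _ s s]]
  show ?thesis
    by simp
qed

lemma has_strong_integral_add:
  fixes f :: "'a \<Rightarrow> 'e::real_normed_vector"
  assumes "has_strong_integral M f v" "has_strong_integral M g w"
  shows "has_strong_integral M (\<lambda>x. f x + g x) (v + w)"
proof -
  obtain s where s: "\<And>i. Bochner_Integration.simple_bochner_integrable M (s i)"
      "(\<lambda>i. \<integral>\<^sup>+x. ennreal (norm (f x - s i x)) \<partial>M) \<longlonglongrightarrow> 0"
      "(\<lambda>i. Bochner_Integration.simple_bochner_integral M (s i)) \<longlonglongrightarrow> v"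
    using assms(1) unfolding has_strong_integral_def by blast
  obtain r where r: "\<And>i. Bochner_Integration.simple_bochner_integrable M (r i)"
      "(\<lambda>i. \<integral>\<^sup>+x. ennreal (norm (g x - r i x)) \<partial>M) \<longlonglongrightarrow> 0"
      "(\<lambda>i. Bochner_Integration.simple_bochner_integral M (r i)) \<longlonglongrightarrow> w"
    using assms(2) unfolding has_strong_integral_def by blast
  have m: "strongly_measurable M f" "strongly_measurable M g"
    using assms by (auto intro: has_strong_integral_measurable)
  show ?thesis
    unfolding has_strong_integral_def
  proof (intro conjI exI[of _ "\<lambda>i x. s i x + r i x"] allI strongly_measurable_add m)
    show "Bochner_Integration.simple_bochner_integrable M (\<lambda>x. s i x + r i x)" for i
      by (rule simple_bochner_integrable_compose2[of "(+)", OF _ s(1) r(1)]) simp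
    show "(\<lambda>i. Bochner_Integration.simple_bochner_integral M (\<lambda>x. s i x + r i x)) \<longlonglongrightarrow> v + w"
      unfolding simple_bochner_integral_add[OF s(1) r(1)] using s(3) r(3) by (rule tendsto_add)
    show "(\<lambda>i. \<integral>\<^sup>+x. ennreal (norm (f x + g x - (s i x + r i x))) \<partial>M) \<longlonglongrightarrow> 0"
    proof (rule tendsto_sandwich[OF _ _ tendsto_const])
      show "(\<lambda>i. (\<integral>\<^sup>+x. ennreal (norm (f x - s i x)) \<partial>M) + (\<integral>\<^sup>+x. ennreal (norm (g x - r i x)) \<partial>M))
        \<longlonglongrightarrow> 0"
        using tendsto_add[OF s(2) r(2)] by simp
      have "(\<integral>\<^sup>+x. ennreal (norm (f x + g x - (s i x + r i x))) \<partial>M)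
        \<le> (\<integral>\<^sup>+x. ennreal (norm (f x - s i x)) \<partial>M) + (\<integral>\<^sup>+x. ennreal (norm (g x - r i x)) \<partial>M)" for i
      proof (rule nn_integral_norm_triangle)
        show "strongly_measurable M (\<lambda>x. f x - s i x)" "strongly_measurable M (\<lambda>x. g x - r i x)"
          by (intro strongly_measurable_diff m
              strongly_measurable_simple[OF simple_bochner_integrableD] s(1) r(1))+
      qed norm
      then show "\<forall>\<^sub>F i in sequentially. (\<integral>\<^sup>+x. ennreal (norm (f x + g x - (s i x + r i x))) \<partial>M)
        \<le> (\<integral>\<^sup>+x. ennreal (norm (f x - s i x)) \<partial>M) + (\<integral>\<^sup>+x. ennreal (norm (g x - r i x)) \<partial>M)"
        by simp
    qed simp
  qed
qed

lemma has_strong_integral_minus: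
  fixes f :: "'a \<Rightarrow> 'e::real_normed_vector"
  assumes "has_strong_integral M f v"
  shows "has_strong_integral M (\<lambda>x. - f x) (- v)"
proof -
  obtain s where s: "\<And>i. Bochner_Integration.simple_bochner_integrable M (s i)"
      "(\<lambda>i. \<integral>\<^sup>+x. ennreal (norm (f x - s i x)) \<partial>M) \<longlonglongrightarrow> 0"
      "(\<lambda>i. Bochner_Integration.simple_bochner_integral M (s i)) \<longlonglongrightarrow> v"
    using assms(1) unfolding has_strong_integral_def by blast
  have "strongly_measurable M (\<lambda>x. - f x)"
    using strongly_measurable_scaleR[OF simple_function_const has_strong_integral_measurable[OF assms], of "- 1"]
    by simp
  moreover have "Bochner_Integration.simple_bochner_integrable M (\<lambda>x. - s i x)" for i
    using simple_bochner_integrable_compose2[of "\<lambda>x _. - x", OF _ s(1) s(1)] by simp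
  moreover have "norm (- f x - (- s i x)) = norm (f x - s i x)" for i x
    by (metis minus_diff_minus norm_minus_cancel)
  moreover have "(\<lambda>i. Bochner_Integration.simple_bochner_integral M (\<lambda>x. - s i x)) \<longlonglongrightarrow> - v"
    unfolding simple_bochner_integral_minus[OF s(1)] using s(3) by (rule tendsto_minus)
  ultimately show ?thesis
    unfolding has_strong_integral_def using s(2)
    by (intro conjI exI[of _ "\<lambda>i x. - s i x"]) auto
qed

lemma has_strong_integral_diff:
  fixes f :: "'a \<Rightarrow> 'e::real_normed_vector"
  assumes "has_strong_integral M f v" "has_strong_integral M g w"
  shows "has_strong_integral M (\<lambda>x. f x - g x) (v - w)"
  using has_strong_integral_add[OF assms(1) has_strong_integral_minus[OF assms(2)]] by simp

section \<open>Norm bound, uniqueness and integrability of the norm\<close>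

lemma norm_has_strong_integral_le:
  fixes f :: "'a \<Rightarrow> 'e::real_normed_vector"
  assumes "has_strong_integral M f v"
  shows "ennreal (norm v) \<le> (\<integral>\<^sup>+x. ennreal (norm (f x)) \<partial>M)"
proof -
  obtain s where s: "\<And>i. Bochner_Integration.simple_bochner_integrable M (s i)"
      "(\<lambda>i. \<integral>\<^sup>+x. ennreal (norm (f x - s i x)) \<partial>M) \<longlonglongrightarrow> 0"
      "(\<lambda>i. Bochner_Integration.simple_bochner_integral M (s i)) \<longlonglongrightarrow> v"
    using assms(1) unfolding has_strong_integral_def by blast
  have m: "strongly_measurable M f"
    using assms by (rule has_strong_integral_measurable)
  show ?thesis
  proof (rule LIMSEQ_le)
    show "(\<lambda>i. ennreal (norm (Bochner_Integration.simple_bochner_integral M (s i)))) \<longlonglongrightarrow> ennreal (norm v)"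
      using s(3) by (intro tendsto_ennrealI tendsto_norm)
    show "(\<lambda>i. (\<integral>\<^sup>+x. ennreal (norm (f x)) \<partial>M) + (\<integral>\<^sup>+x. ennreal (norm (f x - s i x)) \<partial>M))
      \<longlonglongrightarrow> (\<integral>\<^sup>+x. ennreal (norm (f x)) \<partial>M)"
      using tendsto_add[OF tendsto_const s(2)] by simp
    have "ennreal (norm (Bochner_Integration.simple_bochner_integral M (s i)))
      \<le> (\<integral>\<^sup>+x. ennreal (norm (f x)) \<partial>M) + (\<integral>\<^sup>+x. ennreal (norm (f x - s i x)) \<partial>M)" for i
    proof -
      have "ennreal (norm (Bochner_Integration.simple_bochner_integral M (s i)))
        \<le> (\<integral>\<^sup>+x. ennreal (norm (s i x)) \<partial>M)"
        using s(1) by (rule norm_simple_bochner_integral_le)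
      also have "\<dots> \<le> (\<integral>\<^sup>+x. ennreal (norm (f x)) \<partial>M) + (\<integral>\<^sup>+x. ennreal (norm (f x - s i x)) \<partial>M)"
        by (rule nn_integral_norm_triangle[OF m strongly_measurable_diff
              [OF m strongly_measurable_simple[OF simple_bochner_integrableD[OF s(1)]]]]) norm
      finally show ?thesis .
    qed
    then show "\<exists>N. \<forall>i\<ge>N. ennreal (norm (Bochner_Integration.simple_bochner_integral M (s i)))
      \<le> (\<integral>\<^sup>+x. ennreal (norm (f x)) \<partial>M) + (\<integral>\<^sup>+x. ennreal (norm (f x - s i x)) \<partial>M)"
      by blast
  qed
qed

lemma has_strong_integral_unique:
  fixes f :: "'a \<Rightarrow> 'e::real_normed_vector"
  assumes "has_strong_integral M f v" "has_strong_integral M f w"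
  shows "v = w"
proof -
  have "ennreal (norm (v - w)) \<le> 0"
    using norm_has_strong_integral_le[OF has_strong_integral_diff[OF assms]] by simp
  then show ?thesis
    by simp
qed

lemma strong_integral_eq:
  fixes f :: "'a \<Rightarrow> 'e::real_normed_vector"
  shows "has_strong_integral M f v \<Longrightarrow> strong_integral M f = v"
  unfolding strong_integral_def by (blast intro: has_strong_integral_unique)

lemma has_strong_integral_strong_integral:
  fixes f :: "'a \<Rightarrow> 'e::real_normed_vector"
  shows "strongly_integrable M f \<Longrightarrow> has_strong_integral M f (strong_integral M f)"
  unfolding strongly_integrable_def using strong_integral_eq by fastforce

text \<open>A simple function at mean distance below 1 already gives finiteness. This supplies the
  integrable majorant for dominated convergence in
  \<open>tendsto_strong_integral_indicator\<close>.\<close>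

lemma has_strong_integral_norm_finite:
  fixes f :: "'a \<Rightarrow> 'e::real_normed_vector"
  assumes "has_strong_integral M f v"
  shows "(\<integral>\<^sup>+x. ennreal (norm (f x)) \<partial>M) < \<infinity>"
proof -
  obtain s where s: "\<And>i. Bochner_Integration.simple_bochner_integrable M (s i)"
      "(\<lambda>i. \<integral>\<^sup>+x. ennreal (norm (f x - s i x)) \<partial>M) \<longlonglongrightarrow> 0"
    using assms(1) unfolding has_strong_integral_def by blast
  have m: "strongly_measurable M f"
    using assms by (rule has_strong_integral_measurable)
  have "\<forall>\<^sub>F i in sequentially. (\<integral>\<^sup>+x. ennreal (norm (f x - s i x)) \<partial>M) < 1"
    by (rule order_tendstoD(2)[OF s(2)]) simp
  then obtain i where i: "(\<integral>\<^sup>+x. ennreal (norm (f x - s i x)) \<partial>M) < 1"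
    unfolding eventually_sequentially by blast
  have sf: "strongly_measurable M (s i)"
    by (rule strongly_measurable_simple[OF simple_bochner_integrableD[OF s(1)]])
  have "(\<integral>\<^sup>+x. ennreal (norm (s i x)) \<partial>M)
    = ennreal (Bochner_Integration.simple_bochner_integral M (\<lambda>x. norm (s i x)))"
    using simple_bochner_integrable_compose2[of "\<lambda>x _. norm x", OF _ s(1)[of i] s(1)[of i]]
    by (intro simple_bochner_integral_eq_nn_integral[symmetric]) auto
  then have fin: "(\<integral>\<^sup>+x. ennreal (norm (s i x)) \<partial>M) < \<infinity>"
    by simp
  have "(\<integral>\<^sup>+x. ennreal (norm (f x)) \<partial>M)
    \<le> (\<integral>\<^sup>+x. ennreal (norm (s i x)) \<partial>M) + (\<integral>\<^sup>+x. ennreal (norm (f x - s i x)) \<partial>M)"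
    by (rule nn_integral_norm_triangle[OF sf strongly_measurable_diff[OF m sf]]) norm
  also have "\<dots> < \<infinity>"
    using fin i by (auto simp: ennreal_add_less_top intro: order.strict_trans)
  finally show ?thesis .
qed


section \<open>Nonexpansive images and order properties\<close>

text \<open>Extends a nonexpansive map given by its graph \<open>S\<close> to the whole space at the price of the
  factor 3, with values in the closed range. Composing with the extension turns approximating
  simple functions into approximating simple functions.\<close>

lemma nonexpansive_selector:
  fixes S :: "('a::real_normed_vector \<times> 'b::banach) set"
  assumes zero: "(0, 0) \<in> S"
    and lip: "\<And>a b a' b'. (a, b) \<in> S \<Longrightarrow> (a', b') \<in> S \<Longrightarrow> norm (b - b') \<le> norm (a - a')"
  obtains p where "p 0 = 0" "\<And>c. p c \<in> closure (snd ` S)"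
    "\<And>c a b. (a, b) \<in> S \<Longrightarrow> norm (b - p c) \<le> 3 * norm (a - c)"
proof -
  have "\<exists>q. q \<in> closure (snd ` S) \<and> (\<forall>a b. (a, b) \<in> S \<longrightarrow> norm (b - q) \<le> 3 * norm (a - c))" for c
  proof (cases "c \<in> closure (fst ` S)")
    case True
    then obtain u where u: "\<And>n. u n \<in> fst ` S" "u \<longlonglongrightarrow> c"
      unfolding closure_sequential by blast
    then have "\<forall>n. \<exists>b. (u n, b) \<in> S"
      by fastforce
    then obtain w where w: "\<And>n. (u n, w n) \<in> S"
      by metis
    \<comment> \<open>At a limit point of the domain the value is forced: images of a convergent
      sequence are Cauchy, and the estimate even holds with factor 1.\<close>
    have "Cauchy w"
    proof (rule metric_CauchyI)
      fix e :: real assume "0 < e"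
      then obtain N where "\<forall>m\<ge>N. \<forall>n\<ge>N. dist (u m) (u n) < e"
        using metric_CauchyD[OF LIMSEQ_imp_Cauchy[OF u(2)]] by blast
      moreover have "dist (w m) (w n) \<le> dist (u m) (u n)" for m n
        unfolding dist_norm by (rule lip[OF w w])
      ultimately show "\<exists>N. \<forall>m\<ge>N. \<forall>n\<ge>N. dist (w m) (w n) < e"
        by (meson order.strict_trans1)
    qed
    then obtain q where q: "w \<longlonglongrightarrow> q"
      using Cauchy_convergent convergentD by blast
    have "q \<in> closure (snd ` S)"
      unfolding closure_sequential
    proof (intro exI conjI allI)
      show "w n \<in> snd ` S" for n
        using w[of n] by force
    qed fact
    moreover have "norm (b - q) \<le> 3 * norm (a - c)" if "(a, b) \<in> S" for a b
    proof -
      have "norm (b - q) \<le> norm (a - c)"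
      proof (rule LIMSEQ_le)
        show "(\<lambda>n. norm (b - w n)) \<longlonglongrightarrow> norm (b - q)"
          by (intro tendsto_intros q)
        show "(\<lambda>n. norm (a - u n)) \<longlonglongrightarrow> norm (a - c)"
          by (intro tendsto_intros u)
        show "\<exists>N. \<forall>n\<ge>N. norm (b - w n) \<le> norm (a - u n)"
          using lip[OF that w] by blast
      qed
      also have "\<dots> \<le> 3 * norm (a - c)"
        by simp
      finally show ?thesis .
    qed
    ultimately show ?thesis
      by blast
  next
    case False
    have ne: "fst ` S \<noteq> {}"
      using zero by auto
    \<comment> \<open>an almost nearest point \<open>a0\<close> satisfies \<open>norm (a - a0) \<le> norm (a - c) + 2 * infdist c (fst ` S)\<close>\<close>
    let ?d = "infdist c (fst ` S)"
    have "0 < ?d"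
      using False in_closure_iff_infdist_zero[OF ne] infdist_nonneg[of c "fst ` S"] by force
    then have "?d < 2 * ?d"
      by simp
    then have "\<exists>a\<in>fst ` S. dist c a < 2 * ?d"
      unfolding infdist_notempty[OF ne] by (subst (asm) cINF_less_iff[OF ne bdd_below_image_dist])
    then obtain a0 b0 where ab: "(a0, b0) \<in> S" and d: "dist c a0 < 2 * ?d"
      by force
    have "b0 \<in> closure (snd ` S)"
      using ab closure_subset by force
    moreover have "norm (b - b0) \<le> 3 * norm (a - c)" if "(a, b) \<in> S" for a b
    proof -
      have "a \<in> fst ` S"
        using that by force
      then have "?d \<le> dist c a"
        by (rule infdist_le)
      \<comment> \<open>As \<open>a\<close> itself lies in the domain, the infimal distance is at
        most \<open>norm (a - c)\<close>. This turns 1 + 2 into the factor 3.\<close>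
      then have "norm (a - a0) \<le> 3 * norm (a - c)"
        using d dist_triangle[of a a0 c] by (simp add: dist_norm norm_minus_commute)
      with lip[OF that ab] show ?thesis
        by (rule order_trans)
    qed
    ultimately show ?thesis
      by blast
  qed
  then obtain p where p: "\<And>c. p c \<in> closure (snd ` S)"
    "\<And>c a b. (a, b) \<in> S \<Longrightarrow> norm (b - p c) \<le> 3 * norm (a - c)"
    by metis
  \<comment> \<open>Fixing 0 keeps the support of a simple function of finite measure after
    composition with \<open>p\<close>.\<close>
  moreover have "p 0 = 0"
    using p(2)[OF zero, of 0] by simp
  ultimately show ?thesis
    using that by blast
qed

text \<open>The two estimates say that \<open>K\<close> is a nonexpansive function of
  \<open>H\<close>, also after the pair (0, 0) is adjoined. Simple functions take finitely many
  values, so the extension \<open>p\<close> can be composed with approximants of \<open>H\<close> as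
  an arbitrary map; the factor 3 preserves convergence pointwise and in the mean. The location of
  the approximants is recorded for the proof of positivity.\<close>

lemma strongly_integrable_dominated:
  fixes H :: "'a \<Rightarrow> 'e::real_normed_vector" and K :: "'a \<Rightarrow> 'f::banach"
  assumes H: "strongly_integrable M H"
    and norm_le: "\<And>x. x \<in> space M \<Longrightarrow> norm (K x) \<le> norm (H x)"
    and dist_le: "\<And>x y. x \<in> space M \<Longrightarrow> y \<in> space M \<Longrightarrow> norm (K x - K y) \<le> norm (H x - H y)"
  obtains s v where "\<And>i. Bochner_Integration.simple_bochner_integrable M (s i)"
    "\<And>i x. s i x \<in> closure (insert 0 (K ` space M))"
    "(\<lambda>i. Bochner_Integration.simple_bochner_integral M (s i)) \<longlonglongrightarrow> v"
    "has_strong_integral M K v"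
proof -
  let ?S = "insert (0, 0) ((\<lambda>x. (H x, K x)) ` space M)"
  have lip: "norm (b - b') \<le> norm (a - a')" if "(a, b) \<in> ?S" "(a', b') \<in> ?S" for a b a' b'
    using that norm_le dist_le by auto
  obtain p where p0: "p 0 = 0" and p_cl: "\<And>c. p c \<in> closure (snd ` ?S)"
    and p_le: "\<And>c a b. (a, b) \<in> ?S \<Longrightarrow> norm (b - p c) \<le> 3 * norm (a - c)"
    using nonexpansive_selector[of ?S, OF insertI1 lip] by blast
  have K_le: "norm (K x - p c) \<le> 3 * norm (H x - c)" if "x \<in> space M" for x c
    using that by (intro p_le) auto
  obtain r w where w: "has_strong_integral M H w"
    and r: "\<And>i. simple_function M (r i)" "AE x in M. (\<lambda>i. r i x) \<longlonglongrightarrow> H x"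
    using H unfolding strongly_integrable_def has_strong_integral_def strongly_measurable_def by blast
  obtain s where s: "\<And>i. Bochner_Integration.simple_bochner_integrable M (s i)"
      "(\<lambda>i. \<integral>\<^sup>+x. ennreal (norm (H x - s i x)) \<partial>M) \<longlonglongrightarrow> 0"
    using w unfolding has_strong_integral_def by blast
  have K: "strongly_measurable M K"
    unfolding strongly_measurable_def
  proof (intro exI[of _ "\<lambda>i x. p (r i x)"] conjI allI)
    show "simple_function M (\<lambda>x. p (r i x))" for i
      using r(1) by (rule simple_function_compose1)
    show "AE x in M. (\<lambda>i. p (r i x)) \<longlonglongrightarrow> K x"
      using r(2) AE_space
    proof eventually_elim
      case (elim x)
      have "(\<lambda>i. H x - r i x) \<longlonglongrightarrow> H x - H x"
        by (intro tendsto_intros elim(1))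
      then have "(\<lambda>i. H x - r i x) \<longlonglongrightarrow> 0"
        by simp
      then have "(\<lambda>i. K x - p (r i x)) \<longlonglongrightarrow> 0"
        by (rule tendsto_0_le[where K = 3]) (use K_le[OF elim(2)] in \<open>simp add: mult.commute\<close>)
      from tendsto_diff[OF tendsto_const[of "K x"] this] show ?case
        by simp
    qed
  qed
  have ps: "Bochner_Integration.simple_bochner_integrable M (\<lambda>x. p (s i x))" for i
    using simple_bochner_integrable_compose2[of "\<lambda>x _. p x", OF p0 s(1)[of i] s(1)[of i]] .
  have lim: "(\<lambda>i. \<integral>\<^sup>+x. ennreal (norm (K x - p (s i x))) \<partial>M) \<longlonglongrightarrow> 0"
  proof (rule tendsto_sandwich[OF _ _ tendsto_const])
    show "(\<lambda>i. 3 * (\<integral>\<^sup>+x. ennreal (norm (H x - s i x)) \<partial>M)) \<longlonglongrightarrow> 0"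
      using ennreal_tendsto_cmult[OF _ s(2), of 3] by simp
    have "(\<integral>\<^sup>+x. ennreal (norm (K x - p (s i x))) \<partial>M)
      \<le> 3 * (\<integral>\<^sup>+x. ennreal (norm (H x - s i x)) \<partial>M)" for i
    proof -
      have m: "strongly_measurable M (\<lambda>x. H x - s i x)"
        by (intro strongly_measurable_diff has_strong_integral_measurable[OF w]
            strongly_measurable_simple[OF simple_bochner_integrableD[OF s(1)]])
      obtain g :: "'a \<Rightarrow> ennreal" where g: "g \<in> borel_measurable M"
        "AE x in M. ennreal (norm (H x - s i x)) = g x"
        using strongly_measurable_norm[OF m] .
      have "(\<integral>\<^sup>+x. ennreal (norm (K x - p (s i x))) \<partial>M) \<le> (\<integral>\<^sup>+x. 3 * g x \<partial>M)"
      proof (rule nn_integral_mono_AE)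
        show "AE x in M. ennreal (norm (K x - p (s i x))) \<le> 3 * g x"
          using g(2) AE_space
        proof eventually_elim
          case (elim x)
          have "ennreal (norm (K x - p (s i x))) \<le> ennreal (3 * norm (H x - s i x))"
            using K_le[OF elim(2)] by (rule ennreal_leI)
          then show ?case
            by (simp add: ennreal_mult flip: elim(1))
        qed
      qed
      also have "\<dots> = 3 * (\<integral>\<^sup>+x. g x \<partial>M)"
        using g(1) by (rule nn_integral_cmult)
      also have "(\<integral>\<^sup>+x. g x \<partial>M) = (\<integral>\<^sup>+x. ennreal (norm (H x - s i x)) \<partial>M)"
        by (rule nn_integral_cong_AE, rule eventually_mono[OF g(2)]) simp
      finally show ?thesis .
    qed
    then show "\<forall>\<^sub>F i in sequentially. (\<integral>\<^sup>+x. ennreal (norm (K x - p (s i x))) \<partial>M)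
      \<le> 3 * (\<integral>\<^sup>+x. ennreal (norm (H x - s i x)) \<partial>M)"
      by simp
  qed simp
  obtain v where v: "(\<lambda>i. Bochner_Integration.simple_bochner_integral M (\<lambda>x. p (s i x))) \<longlonglongrightarrow> v"
    "has_strong_integral M K v"
    using strongly_integrableI[OF K ps lim] .
  have "snd ` ?S = insert 0 (K ` space M)"
    by (simp add: image_image)
  then have "p c \<in> closure (insert 0 (K ` space M))" for c
    using p_cl[of c] by simp
  then show ?thesis
    using that[of "\<lambda>i x. p (s i x)" v] ps v by blast
qed

section \<open>Positivity and monotonicity of the integral\<close>

lemma has_strong_integral_nonneg:
  fixes f :: "'a \<Rightarrow> 'e::ordered_banach"
  assumes f: "has_strong_integral M f v" and nonneg: "\<And>x. x \<in> space M \<Longrightarrow> 0 \<le> f x"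
  shows "0 \<le> v"
proof -
  have "strongly_integrable M f"
    using f unfolding strongly_integrable_def by blast
  \<comment> \<open>This is the instance \<open>K = H = f\<close>: the estimates are trivial, and
    the gain is that the new approximants take values in the closure of the range of
    \<open>f\<close> with 0.\<close>
  then obtain s w where s: "\<And>i x. s i x \<in> closure (insert 0 (f ` space M))"
    and lim: "(\<lambda>i. Bochner_Integration.simple_bochner_integral M (s i)) \<longlonglongrightarrow> w"
    and w: "has_strong_integral M f w"
    by (rule strongly_integrable_dominated) auto
  have "closure (insert 0 (f ` space M)) \<subseteq> {x. 0 \<le> x}"
    using nonneg by (intro closure_minimal closed_positive_cone) auto
  with s have "0 \<le> s i x" for i x
    by blast
  then have "Bochner_Integration.simple_bochner_integral M (s i) \<in> {x. 0 \<le> x}" for i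
    unfolding simple_bochner_integral_def by (auto intro!: sum_nonneg scaleR_nonneg_nonneg)
  then have "w \<in> {x. 0 \<le> x}"
    by (rule closed_sequentially[OF closed_positive_cone _ lim])
  with has_strong_integral_unique[OF f w] show ?thesis
    by simp
qed

lemma has_strong_integral_mono:
  fixes f g :: "'a \<Rightarrow> 'e::ordered_banach"
  assumes "has_strong_integral M f v" "has_strong_integral M g w"
    and "\<And>x. x \<in> space M \<Longrightarrow> f x \<le> g x"
  shows "v \<le> w"
  using has_strong_integral_nonneg[OF has_strong_integral_diff[OF assms(2,1)]] assms(3) by simp

section \<open>Restriction and truncation of the domain\<close>

lemma has_strong_integral_restrict_space:
  fixes f :: "'a \<Rightarrow> 'e::real_normed_vector"
  assumes S: "S \<inter> space M \<in> sets M" and f: "has_strong_integral (restrict_space M S) f v"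
  shows "has_strong_integral M (\<lambda>x. indicator S x *\<^sub>R f x) v"
proof -
  obtain r s where r: "\<And>i. simple_function (restrict_space M S) (r i)"
      "AE x in restrict_space M S. (\<lambda>i. r i x) \<longlonglongrightarrow> f x"
    and s: "\<And>i. Bochner_Integration.simple_bochner_integrable (restrict_space M S) (s i)"
      "(\<lambda>i. \<integral>\<^sup>+x. ennreal (norm (f x - s i x)) \<partial>restrict_space M S) \<longlonglongrightarrow> 0"
      "(\<lambda>i. Bochner_Integration.simple_bochner_integral (restrict_space M S) (s i)) \<longlonglongrightarrow> v"
    using f unfolding has_strong_integral_def strongly_measurable_def by blast
  have "strongly_measurable M (\<lambda>x. indicator S x *\<^sub>R f x)"
    unfolding strongly_measurable_def
  proof (intro exI[of _ "\<lambda>i x. indicator S x *\<^sub>R r i x"] conjI allI)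
    show "simple_function M (\<lambda>x. indicator S x *\<^sub>R r i x)" for i
      using r(1) by (simp add: simple_function_restrict_space[OF S])
    have "AE x in M. x \<in> S \<longrightarrow> (\<lambda>i. r i x) \<longlonglongrightarrow> f x"
      using r(2) by (simp add: AE_restrict_space_iff[OF S])
    then show "AE x in M. (\<lambda>i. indicator S x *\<^sub>R r i x) \<longlonglongrightarrow> indicator S x *\<^sub>R f x"
      by (rule eventually_mono) (simp add: indicator_def)
  qed
  moreover have "Bochner_Integration.simple_bochner_integrable M (\<lambda>x. indicator S x *\<^sub>R s i x)" for i
    using s(1) by (simp add: simple_bochner_integrable_restrict_space[OF S])
  moreover have "(\<integral>\<^sup>+x. ennreal (norm (indicator S x *\<^sub>R f x - indicator S x *\<^sub>R s i x)) \<partial>M)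
    = (\<integral>\<^sup>+x. ennreal (norm (f x - s i x)) \<partial>restrict_space M S)" for i
    unfolding nn_integral_restrict_space[OF S]
    by (intro nn_integral_cong) (simp add: indicator_def)
  ultimately show ?thesis
    unfolding has_strong_integral_def
    using s(2,3) unfolding simple_bochner_integral_restrict_space[OF S s(1)]
    by (intro conjI exI[of _ "\<lambda>i x. indicator S x *\<^sub>R s i x"] allI) simp_all
qed

lemma strongly_integrable_indicator:
  fixes f :: "'a \<Rightarrow> 'e::banach"
  assumes "strongly_integrable M f" "A \<in> sets M"
  shows "strongly_integrable M (\<lambda>x. indicator A x *\<^sub>R f x)"
proof -
  obtain v where v: "has_strong_integral M f v"
    using assms unfolding strongly_integrable_def by blast
  then obtain s where s: "\<And>i. Bochner_Integration.simple_bochner_integrable M (s i)"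
      "(\<lambda>i. \<integral>\<^sup>+x. ennreal (norm (f x - s i x)) \<partial>M) \<longlonglongrightarrow> 0"
    unfolding has_strong_integral_def by blast
  have A: "simple_function M (indicator A :: 'a \<Rightarrow> real)"
    using assms(2) by (rule simple_function_indicator)
  have 1: "strongly_measurable M (\<lambda>x. indicator A x *\<^sub>R f x)"
    using A has_strong_integral_measurable[OF v] by (rule strongly_measurable_scaleR)
  have 2: "Bochner_Integration.simple_bochner_integrable M (\<lambda>x. indicator A x *\<^sub>R s i x)" for i
  proof
    show "simple_function M (\<lambda>x. indicator A x *\<^sub>R s i x)"
      using A simple_bochner_integrableD[OF s(1)] by (rule simple_function_compose2)
    have "s i -` (- {0}) \<inter> space M \<in> sets M"
      by (rule simple_functionD(2)[OF simple_bochner_integrableD[OF s(1)]])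
    also have "s i -` (- {0}) \<inter> space M = {x \<in> space M. s i x \<noteq> 0}"
      by auto
    finally have "emeasure M {y \<in> space M. indicator A y *\<^sub>R s i y \<noteq> 0} \<le> emeasure M {y \<in> space M. s i y \<noteq> 0}"
      by (intro emeasure_mono) auto
    also have "\<dots> < \<infinity>"
      using s(1)[of i] by (simp add: simple_bochner_integrable.simps less_top)
    finally show "emeasure M {y \<in> space M. indicator A y *\<^sub>R s i y \<noteq> 0} \<noteq> \<infinity>"
      by simp
  qed
  have 3: "(\<lambda>i. \<integral>\<^sup>+x. ennreal (norm (indicator A x *\<^sub>R f x - indicator A x *\<^sub>R s i x)) \<partial>M) \<longlonglongrightarrow> 0"
  proof (rule tendsto_sandwich[OF _ _ tendsto_const s(2)])
    have "(\<integral>\<^sup>+x. ennreal (norm (indicator A x *\<^sub>R f x - indicator A x *\<^sub>R s i x)) \<partial>M)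
      \<le> (\<integral>\<^sup>+x. ennreal (norm (f x - s i x)) \<partial>M)" for i
      by (intro nn_integral_mono) (simp add: indicator_def)
    then show "\<forall>\<^sub>F i in sequentially.
      (\<integral>\<^sup>+x. ennreal (norm (indicator A x *\<^sub>R f x - indicator A x *\<^sub>R s i x)) \<partial>M)
      \<le> (\<integral>\<^sup>+x. ennreal (norm (f x - s i x)) \<partial>M)"
      by simp
  qed simp
  show ?thesis
    using strongly_integrableI[OF 1 2 3] unfolding strongly_integrable_def by blast
qed

text \<open>The error is at most the integral of the norm of \<open>f\<close> outside
  \<open>A n\<close>, which reduces the claim to scalar dominated convergence. It later exhausts the
  real line by bounded intervals.\<close>

lemma tendsto_strong_integral_indicator:
  fixes f :: "'a \<Rightarrow> 'e::banach"
  assumes f: "has_strong_integral M f v" and A: "\<And>n. A n \<in> sets M"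
    and ev: "\<And>x. x \<in> space M \<Longrightarrow> \<forall>\<^sub>F n in sequentially. x \<in> A n"
  shows "(\<lambda>n. strong_integral M (\<lambda>x. indicator (A n) x *\<^sub>R f x)) \<longlonglongrightarrow> v"
proof -
  let ?I = "\<lambda>n. strong_integral M (\<lambda>x. indicator (A n) x *\<^sub>R f x)"
  obtain g :: "'a \<Rightarrow> ennreal" where g: "g \<in> borel_measurable M" "AE x in M. ennreal (norm (f x)) = g x"
    using strongly_measurable_norm[OF has_strong_integral_measurable[OF f]] .
  have fin: "(\<integral>\<^sup>+x. g x \<partial>M) < \<infinity>"
    using has_strong_integral_norm_finite[OF f] nn_integral_cong_AE[OF g(2)] by simp
  have le: "ennreal (norm (v - ?I n)) \<le> (\<integral>\<^sup>+x. g x * indicator (space M - A n) x \<partial>M)" for n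
  proof -
    have "strongly_integrable M f"
      using f unfolding strongly_integrable_def by blast
    then have "has_strong_integral M (\<lambda>x. indicator (A n) x *\<^sub>R f x) (?I n)"
      by (intro has_strong_integral_strong_integral strongly_integrable_indicator A)
    then have "ennreal (norm (v - ?I n)) \<le> (\<integral>\<^sup>+x. ennreal (norm (f x - indicator (A n) x *\<^sub>R f x)) \<partial>M)"
      by (intro norm_has_strong_integral_le has_strong_integral_diff f)
    also have "\<dots> = (\<integral>\<^sup>+x. g x * indicator (space M - A n) x \<partial>M)"
    proof (rule nn_integral_cong_AE)
      show "AE x in M. ennreal (norm (f x - indicator (A n) x *\<^sub>R f x)) = g x * indicator (space M - A n) x"
        using g(2) AE_space by eventually_elim (simp add: indicator_def)
    qed
    finally show ?thesis .
  qed
  have "(\<lambda>n. \<integral>\<^sup>+x. g x * indicator (space M - A n) x \<partial>M) \<longlonglongrightarrow> (\<integral>\<^sup>+x. 0 \<partial>M)"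
  proof (rule nn_integral_dominated_convergence[OF _ _ g(1) _ fin])
    show "(\<lambda>x. g x * indicator (space M - A n) x) \<in> borel_measurable M" for n
      using g(1) A by (intro borel_measurable_times_ennreal borel_measurable_indicator) auto
    show "AE x in M. g x * indicator (space M - A n) x \<le> g x" for n
      by (simp add: indicator_def)
    show "AE x in M. (\<lambda>n. g x * indicator (space M - A n) x) \<longlonglongrightarrow> 0"
    proof (rule AE_I2)
      fix x assume "x \<in> space M"
      then have "\<forall>\<^sub>F n in sequentially. g x * indicator (space M - A n) x = 0"
        by (intro eventually_mono[OF ev]) auto
      then show "(\<lambda>n. g x * indicator (space M - A n) x) \<longlonglongrightarrow> 0"
        by (rule tendsto_eventually)
    qed
  qed simp
  then have lim: "(\<lambda>n. \<integral>\<^sup>+x. g x * indicator (space M - A n) x \<partial>M) \<longlonglongrightarrow> 0"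
    by simp
  have "(\<lambda>n. ennreal (norm (v - ?I n))) \<longlonglongrightarrow> 0"
  proof (rule tendsto_sandwich[OF _ _ tendsto_const lim])
    show "\<forall>\<^sub>F n in sequentially. ennreal (norm (v - ?I n))
      \<le> (\<integral>\<^sup>+x. g x * indicator (space M - A n) x \<partial>M)"
      using le by (intro always_eventually allI)
  qed simp
  then have "(\<lambda>n. norm (v - ?I n)) \<longlonglongrightarrow> 0"
    unfolding ennreal_0[symmetric] by (subst (asm) tendsto_ennreal_iff) simp_all
  then have "(\<lambda>n. ?I n - v) \<longlonglongrightarrow> 0"
    by (intro tendsto_norm_zero_cancel[of "\<lambda>n. ?I n - v"]) (simp add: norm_minus_commute)
  then show ?thesis
    by (rule LIM_zero_cancel)
qed


section \<open>Sums of capacities of level sets\<close>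

lemma lattice_of_setsD:
  assumes "lattice_of_sets X \<Sigma>" "A \<in> \<Sigma>" "B \<in> \<Sigma>"
  shows "A \<union> B \<in> \<Sigma>" "A \<inter> B \<in> \<Sigma>"
  using assms unfolding lattice_of_sets_def by auto

lemma lattice_measurable_level:
  assumes "lattice_of_sets X \<Sigma>" "lattice_measurable X \<Sigma> f" "A \<in> \<Sigma>"
  shows "{x \<in> A. t \<le> f x} \<in> \<Sigma>"
proof -
  have "A \<inter> {x \<in> X. t \<le> f x} \<in> \<Sigma>"
    using assms by (intro lattice_of_setsD) (auto simp: lattice_measurable_def)
  also have "A \<inter> {x \<in> X. t \<le> f x} = {x \<in> A. t \<le> f x}"
    using assms(1,3) unfolding lattice_of_sets_def by auto
  finally show ?thesis .
qed

lemma vector_capacityD: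
  assumes "vector_capacity \<Sigma> \<mu>"
  shows "A \<in> \<Sigma> \<Longrightarrow> 0 \<le> \<mu> A" "\<mu> {} = 0"
    "A \<in> \<Sigma> \<Longrightarrow> B \<in> \<Sigma> \<Longrightarrow> A \<subseteq> B \<Longrightarrow> \<mu> A \<le> \<mu> B"
  using assms unfolding vector_capacity_def by auto

lemma submodularD:
  "submodular \<Sigma> \<mu> \<Longrightarrow> A \<in> \<Sigma> \<Longrightarrow> B \<in> \<Sigma> \<Longrightarrow> \<mu> (A \<union> B) + \<mu> (A \<inter> B) \<le> \<mu> A + \<mu> B"
  unfolding submodular_def by blast

text \<open>Adding the indicator of \<open>B\<close> changes the level set \<open>C (Suc i)\<close>
  into \<open>C (Suc i) \<union> (C i \<inter> B)\<close>. Submodularity bounds the increase of its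
  capacity by \<open>\<mu> (C i \<inter> B) - \<mu> (C (Suc i) \<inter> B)\<close>, and these bounds
  telescope from \<open>C 0 \<inter> B = B\<close> down to the empty set.\<close>

lemma sum_level_sets_add_indicator:
  fixes c :: "'x \<Rightarrow> nat" and \<mu> :: "'x set \<Rightarrow> 'e::ordered_banach"
  assumes lat: "lattice_of_sets X \<Sigma>" and cap: "vector_capacity \<Sigma> \<mu>" and sub: "submodular \<Sigma> \<mu>"
    and c: "\<And>i. {x \<in> A. i < c x} \<in> \<Sigma>" "\<And>x. x \<in> A \<Longrightarrow> c x \<le> m"
    and A: "A \<in> \<Sigma>" and B: "B \<in> \<Sigma>" "B \<subseteq> A"
  shows "{x \<in> A. i < c x + of_bool (x \<in> B)} \<in> \<Sigma>"
    and "(\<Sum>i<Suc m. \<mu> {x \<in> A. i < c x + of_bool (x \<in> B)}) \<le> (\<Sum>i<m. \<mu> {x \<in> A. i < c x}) + \<mu> B"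
proof -
  define C where "C k = {x \<in> A. k \<le> c x}" for k
  have C_0: "C 0 = A" and C_Suc: "C (Suc i) = {x \<in> A. i < c x}" for i
    by (auto simp: C_def)
  have C: "C k \<in> \<Sigma>" for k
    using A c(1) by (cases k) (simp_all add: C_0 C_Suc)
  have level_add: "{x \<in> A. i < c x + of_bool (x \<in> B)} = C (Suc i) \<union> (C i \<inter> B)" for i
    using B(2) by (auto simp: C_def of_bool_def split: if_splits)
  show "{x \<in> A. i < c x + of_bool (x \<in> B)} \<in> \<Sigma>"
    unfolding level_add by (intro lattice_of_setsD[OF lat] C B)
  have "\<mu> (C (Suc i) \<union> (C i \<inter> B)) + \<mu> (C (Suc i) \<inter> B) \<le> \<mu> (C (Suc i)) + \<mu> (C i \<inter> B)" for i
  proof -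
    \<comment> \<open>The sets \<open>C k\<close> decrease in \<open>k\<close>; this makes the
      intersection term the next term of the telescoping sum.\<close>
    have "C (Suc i) \<inter> B = C (Suc i) \<inter> (C i \<inter> B)"
      by (auto simp: C_def)
    then show ?thesis
      using submodularD[OF sub C lattice_of_setsD(2)[OF lat C B(1)], of "Suc i" i] by simp
  qed
  then have "(\<Sum>i<Suc m. \<mu> (C (Suc i) \<union> (C i \<inter> B)) + \<mu> (C (Suc i) \<inter> B))
    \<le> (\<Sum>i<Suc m. \<mu> (C (Suc i)) + \<mu> (C i \<inter> B))"
    by (rule sum_mono)
  then have le: "(\<Sum>i<Suc m. \<mu> (C (Suc i) \<union> (C i \<inter> B))) + (\<Sum>i<Suc m. \<mu> (C (Suc i) \<inter> B))
    \<le> (\<Sum>i<Suc m. \<mu> (C (Suc i))) + (\<Sum>i<Suc m. \<mu> (C i \<inter> B))"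
    by (simp only: sum.distrib)
  have C_Suc_m: "C (Suc m) = {}"
    using c(2) by (force simp: C_def)
  have "C 0 \<inter> B = B"
    using B(2) C_0 by auto
  then have "(\<Sum>i<Suc m. \<mu> (C i \<inter> B)) - (\<Sum>i<Suc m. \<mu> (C (Suc i) \<inter> B)) = \<mu> B"
    using sum_lessThan_telescope'[of "\<lambda>i. \<mu> (C i \<inter> B)" "Suc m"] vector_capacityD(2)[OF cap] C_Suc_m
    by (simp only: sum_subtractf) simp
  then have "(\<Sum>i<Suc m. \<mu> (C i \<inter> B)) = \<mu> B + (\<Sum>i<Suc m. \<mu> (C (Suc i) \<inter> B))"
    by (simp only: diff_eq_eq)
  with le have "(\<Sum>i<Suc m. \<mu> (C (Suc i) \<union> (C i \<inter> B))) \<le> (\<Sum>i<Suc m. \<mu> (C (Suc i))) + \<mu> B"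
    by (simp only: add.assoc[symmetric] add_le_cancel_right)
  also have "(\<Sum>i<Suc m. \<mu> (C (Suc i))) = (\<Sum>i<m. \<mu> (C (Suc i)))"
    by (simp add: C_Suc_m vector_capacityD(2)[OF cap])
  finally show "(\<Sum>i<Suc m. \<mu> {x \<in> A. i < c x + of_bool (x \<in> B)}) \<le> (\<Sum>i<m. \<mu> {x \<in> A. i < c x}) + \<mu> B"
    unfolding level_add C_Suc .
qed

text \<open>Raising the cap from \<open>N\<close> to \<open>Suc N\<close> adds to
  \<open>min (v x) N\<close> the indicator of the level set where \<open>N < v x\<close>. Membership
  in \<Sigma> is carried through the induction because each step applies submodularity to the level
  sets of the previous sum.\<close>

lemma sum_level_sets_add:
  fixes u v :: "'x \<Rightarrow> nat" and \<mu> :: "'x set \<Rightarrow> 'e::ordered_banach"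
  assumes lat: "lattice_of_sets X \<Sigma>" and cap: "vector_capacity \<Sigma> \<mu>" and sub: "submodular \<Sigma> \<mu>"
    and A: "A \<in> \<Sigma>" and u: "\<And>i. {x \<in> A. i < u x} \<in> \<Sigma>" "\<And>x. x \<in> A \<Longrightarrow> u x \<le> M"
    and v: "\<And>i. {x \<in> A. i < v x} \<in> \<Sigma>"
  shows "(\<forall>i. {x \<in> A. i < u x + min (v x) N} \<in> \<Sigma>) \<and>
    (\<Sum>i<M + N. \<mu> {x \<in> A. i < u x + min (v x) N})
      \<le> (\<Sum>i<M. \<mu> {x \<in> A. i < u x}) + (\<Sum>i<N. \<mu> {x \<in> A. i < v x})"
proof (induction N)
  case 0
  show ?case
    using u(1) by simp
next
  case (Suc N)
  let ?c = "\<lambda>x. u x + min (v x) N" and ?B = "{x \<in> A. N < v x}"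
  have eq: "{x \<in> A. i < u x + min (v x) (Suc N)} = {x \<in> A. i < ?c x + of_bool (x \<in> ?B)}" for i
    by (intro Collect_cong) (auto simp: min_def of_bool_def)
  have c: "?c x \<le> M + N" if "x \<in> A" for x
    using u(2)[OF that] by linarith
  have B: "?B \<in> \<Sigma>" "?B \<subseteq> A"
    using v by auto
  note step = sum_level_sets_add_indicator[of _ _ _ _ ?c, OF lat cap sub _ c A B]
  have "{x \<in> A. i < u x + min (v x) (Suc N)} \<in> \<Sigma>" for i
    unfolding eq using Suc.IH by (intro step) auto
  moreover have "(\<Sum>i<Suc (M + N). \<mu> {x \<in> A. i < u x + min (v x) (Suc N)})
    \<le> (\<Sum>i<M + N. \<mu> {x \<in> A. i < ?c x}) + \<mu> ?B"
    unfolding eq using Suc.IH by (intro step) auto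
  ultimately show ?case
    using Suc.IH by (auto intro: order_trans simp: algebra_simps)
qed

text \<open>The levels of \<open>f\<close> and \<open>g\<close> run up to \<open>3 n h\<close> but those of \<open>f + g\<close> only up to about \<open>2 n h\<close>: after
  cutting off below at \<open>- n h\<close>, a sum below \<open>2 n h\<close> has summands below \<open>3 n h\<close>. The extra \<open>h\<close> on
  the left absorbs the rounding error of the floor function.\<close>

lemma sum_real_level_sets_add:
  fixes f g :: "'x \<Rightarrow> real" and \<mu> :: "'x set \<Rightarrow> 'e::ordered_banach"
  assumes lat: "lattice_of_sets X \<Sigma>" and cap: "vector_capacity \<Sigma> \<mu>" and sub: "submodular \<Sigma> \<mu>"
    and A: "A \<in> \<Sigma>" and f: "lattice_measurable X \<Sigma> f" and g: "lattice_measurable X \<Sigma> g"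
    and fg: "lattice_measurable X \<Sigma> (\<lambda>x. f x + g x)" and h: "0 < h"
  shows "(\<Sum>i<4 * n. \<mu> {x \<in> A. (2 - 2 * real n) * h + real i * h \<le> f x + g x})
    \<le> (\<Sum>i<4 * n. \<mu> {x \<in> A. - real n * h + real (Suc i) * h \<le> f x})
      + (\<Sum>i<4 * n. \<mu> {x \<in> A. - real n * h + real (Suc i) * h \<le> g x})"
proof -
  \<comment> \<open>The shift by \<open>n\<close> moves the lower cutoff \<open>- n h\<close> to 0,
    and \<open>nat\<close> performs the cutoff.\<close>
  define r where "r f x = nat (\<lfloor>f x / h\<rfloor> + int n)" for f :: "'x \<Rightarrow> real" and x
  have r_iff: "i < r f x \<longleftrightarrow> - real n * h + real (Suc i) * h \<le> f x" for f i x
  proof -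
    have "i < r f x \<longleftrightarrow> int i + 1 - int n \<le> \<lfloor>f x / h\<rfloor>"
      unfolding r_def by linarith
    also have "\<dots> \<longleftrightarrow> real_of_int (int i + 1 - int n) \<le> f x / h"
      by (rule le_floor_iff)
    also have "\<dots> \<longleftrightarrow> - real n * h + real (Suc i) * h \<le> f x"
      using h by (simp add: field_simps)
    finally show ?thesis .
  qed
  \<comment> \<open>\<open>sum_level_sets_add\<close> caps its second function by itself but expects
    a bounded first one. Capping at \<open>4 * n\<close> leaves the levels below
    \<open>4 * n\<close> unchanged.\<close>
  let ?u = "\<lambda>x. min (r f x) (4 * n)" and ?N = "4 * n"
  have r: "{x \<in> A. i < r f x} \<in> \<Sigma>" "{x \<in> A. i < r g x} \<in> \<Sigma>" for i
    unfolding r_iff by (intro lattice_measurable_level[OF lat _ A] f g)+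
  have u: "{x \<in> A. i < ?u x} \<in> \<Sigma>" for i
  proof (cases "i < 4 * n")
    case True
    then show ?thesis
      using r(1) by simp
  next
    case False
    then show ?thesis
      using lat by (simp add: lattice_of_sets_def)
  qed
  have "?u x \<le> ?N" for x
    by simp
  note main = sum_level_sets_add[OF lat cap sub A u this r(2), of ?N]
  have "(\<Sum>i<?N. \<mu> {x \<in> A. (2 - 2 * real n) * h + real i * h \<le> f x + g x})
    \<le> (\<Sum>i<?N. \<mu> {x \<in> A. i < ?u x + min (r g x) ?N})"
  proof (intro sum_mono vector_capacityD(3)[OF cap] lattice_measurable_level[OF lat fg A])
    show "{x \<in> A. i < ?u x + min (r g x) ?N} \<in> \<Sigma>" for i
      using main by blast
    fix i assume "i \<in> {..<?N}"
    then have i: "i < 4 * n"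
      by simp
    have "i < ?u x + min (r g x) ?N" if "(2 - 2 * real n) * h + real i * h \<le> f x + g x" for x
    proof -
      have "real_of_int (int i + 2 - 2 * int n) \<le> f x / h + g x / h"
        using that h by (simp add: field_simps)
      \<comment> \<open>Two floors lose less than 2 together, so by integrality the bound
        \<open>i + 2\<close> drops only to \<open>i + 1\<close>.\<close>
      then have "int i + 1 - 2 * int n \<le> \<lfloor>f x / h\<rfloor> + \<lfloor>g x / h\<rfloor>"
        by linarith
      then have "int i + 1 \<le> int (r f x) + int (r g x)"
        unfolding r_def by linarith
      \<comment> \<open>If a cap is active, that term alone is \<open>4 * n\<close>, which exceeds
        \<open>i\<close>.\<close>
      with i show ?thesis
        by linarith
    qed
    then show "{x \<in> A. (2 - 2 * real n) * h + real i * h \<le> f x + g x} \<subseteq> {x \<in> A. i < ?u x + min (r g x) ?N}"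
      by blast
  qed
  also have "\<dots> \<le> (\<Sum>i<?N + ?N. \<mu> {x \<in> A. i < ?u x + min (r g x) ?N})"
    using main by (intro sum_mono2 vector_capacityD(1)[OF cap]) auto
  also have "\<dots> \<le> (\<Sum>i<?N. \<mu> {x \<in> A. i < ?u x}) + (\<Sum>i<?N. \<mu> {x \<in> A. i < r g x})"
    using main by blast
  also have "(\<Sum>i<?N. \<mu> {x \<in> A. i < ?u x}) = (\<Sum>i<?N. \<mu> {x \<in> A. i < r f x})"
    by (intro sum.cong refl arg_cong[where f = \<mu>]) auto
  finally show ?thesis
    unfolding r_iff .
qed


section \<open>Subadditivity of the Choquet-Bochner integral\<close>

lemma has_strong_integral_imp_strongly_integrable:
  "has_strong_integral M f v \<Longrightarrow> strongly_integrable M f"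
  unfolding strongly_integrable_def by blast

section \<open>Integrals of decreasing functions over bounded intervals\<close>

text \<open>With half-open intervals adjacent pieces are disjoint, so splitting an interval is a
  pointwise identity of the integrands.\<close>

definition interval_integral :: "(real \<Rightarrow> 'e::banach) \<Rightarrow> real \<Rightarrow> real \<Rightarrow> 'e" where
  "interval_integral F b c = strong_integral lebesgue (\<lambda>t. indicator {b<..c} t *\<^sub>R F t)"

definition locally_integrable :: "(real \<Rightarrow> 'e::banach) \<Rightarrow> bool" where
  "locally_integrable F \<longleftrightarrow> (\<forall>b c. strongly_integrable lebesgue (\<lambda>t. indicator {b<..c} t *\<^sub>R F t))"

lemma has_interval_integral:
  "locally_integrable F \<Longrightarrow>
    has_strong_integral lebesgue (\<lambda>t. indicator {b<..c} t *\<^sub>R F t) (interval_integral F b c)"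
  unfolding locally_integrable_def interval_integral_def
  by (simp add: has_strong_integral_strong_integral)

lemma interval_integral_eq:
  "has_strong_integral lebesgue (\<lambda>t. indicator {b<..c} t *\<^sub>R F t) v \<Longrightarrow> interval_integral F b c = v"
  unfolding interval_integral_def by (rule strong_integral_eq)

lemma has_strong_integral_interval_const:
  "b \<le> c \<Longrightarrow> has_strong_integral lebesgue (\<lambda>t. indicator {b<..c} t *\<^sub>R a) ((c - b) *\<^sub>R a)"
  using has_strong_integral_indicator[of "{b<..c}" lebesgue a] by simp

lemma interval_integral_combine:
  assumes F: "locally_integrable F" and "b \<le> c" "c \<le> d"
  shows "interval_integral F b d = interval_integral F b c + interval_integral F c d"
proof (rule interval_integral_eq, rule has_strong_integral_cong_AE)
  show "has_strong_integral lebesgue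
      (\<lambda>t. indicator {b<..c} t *\<^sub>R F t + indicator {c<..d} t *\<^sub>R F t)
      (interval_integral F b c + interval_integral F c d)"
    by (intro has_strong_integral_add has_interval_integral F)
  show "AE t in lebesgue. indicator {b<..c} t *\<^sub>R F t + indicator {c<..d} t *\<^sub>R F t
      = indicator {b<..d} t *\<^sub>R F t"
    using assms(2,3) by (intro AE_I2) (auto simp: indicator_def)
qed

lemma interval_integral_bounds:
  fixes F :: "real \<Rightarrow> 'e::ordered_banach"
  assumes F: "locally_integrable F" "antimono F" and "b \<le> c"
  shows "(c - b) *\<^sub>R F c \<le> interval_integral F b c" "interval_integral F b c \<le> (c - b) *\<^sub>R F b"
proof -
  note const = has_strong_integral_interval_const[OF \<open>b \<le> c\<close>]
  show "(c - b) *\<^sub>R F c \<le> interval_integral F b c"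
    by (rule has_strong_integral_mono[OF const has_interval_integral[OF F(1)]])
      (auto simp: indicator_def intro: antimonoD[OF F(2)])
  show "interval_integral F b c \<le> (c - b) *\<^sub>R F b"
    by (rule has_strong_integral_mono[OF has_interval_integral[OF F(1)] const])
      (auto simp: indicator_def intro: antimonoD[OF F(2)])
qed

lemma interval_integral_riemann_bounds:
  fixes F :: "real \<Rightarrow> 'e::ordered_banach"
  assumes F: "locally_integrable F" "antimono F" and h: "0 \<le> h"
  shows "h *\<^sub>R (\<Sum>i<n. F (b + real (Suc i) * h)) \<le> interval_integral F b (b + real n * h) \<and>
    interval_integral F b (b + real n * h) \<le> h *\<^sub>R (\<Sum>i<n. F (b + real i * h))"
proof (induction n)
  case 0
  \<comment> \<open>On the degenerate interval the upper and the lower bound are both 0.\<close>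
  have "interval_integral F b b = 0"
    using interval_integral_bounds[OF F, of b b] by (simp add: order_antisym)
  then show ?case
    by simp
next
  case (Suc n)
  let ?d = "b + real n * h" and ?e = "b + real (Suc n) * h"
  have le: "b \<le> ?d" "?d \<le> ?e" and eq: "?e - ?d = h"
    using h by (auto simp: algebra_simps)
  show ?case
    using Suc.IH interval_integral_bounds[OF F le(2)]
    unfolding interval_integral_combine[OF F(1) le] sum.lessThan_Suc scaleR_add_right eq
    by (auto intro: add_mono)
qed

section \<open>The Choquet-Bochner integral over the whole line and its truncations\<close>

lemma CB_integrableD:
  assumes "CB_integrable X \<Sigma> \<mu> f"
  shows "lattice_measurable X \<Sigma> f"
    and "A \<in> \<Sigma> \<Longrightarrow> strongly_integrable (lebesgue_on {0..}) (\<lambda>t. \<mu> {x \<in> A. t \<le> f x})"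
    and "A \<in> \<Sigma> \<Longrightarrow> strongly_integrable (lebesgue_on {..0}) (\<lambda>t. \<mu> {x \<in> A. t \<le> f x} - \<mu> A)"
  using assms unfolding CB_integrable_def by auto

lemma has_strong_integral_CB_integral:
  fixes \<mu> :: "'x set \<Rightarrow> 'e::ordered_banach"
  assumes "CB_integrable X \<Sigma> \<mu> f" "A \<in> \<Sigma>"
  shows "has_strong_integral lebesgue (\<lambda>t. \<mu> {x \<in> A. t \<le> f x} - indicator {..0} t *\<^sub>R \<mu> A)
    (CB_integral \<mu> A f)"
proof (rule has_strong_integral_cong_AE)
  show "has_strong_integral lebesgue
      (\<lambda>t. indicator {0..} t *\<^sub>R \<mu> {x \<in> A. t \<le> f x} + indicator {..0} t *\<^sub>R (\<mu> {x \<in> A. t \<le> f x} - \<mu> A))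
      (CB_integral \<mu> A f)"
    unfolding CB_integral_def
    by (intro has_strong_integral_add has_strong_integral_restrict_space
        has_strong_integral_strong_integral CB_integrableD[OF assms(1)] assms(2)) auto
  \<comment> \<open>Both half-lines contain 0, so the summed integrand counts the level set there
    twice; a null set removes this.\<close>
  have "AE t in lebesgue. t \<noteq> (0 :: real)"
    by (rule AE_I'[of "{0}"]) auto
  then show "AE t in lebesgue.
      indicator {0..} t *\<^sub>R \<mu> {x \<in> A. t \<le> f x} + indicator {..0} t *\<^sub>R (\<mu> {x \<in> A. t \<le> f x} - \<mu> A)
      = \<mu> {x \<in> A. t \<le> f x} - indicator {..0} t *\<^sub>R \<mu> A"
    by (rule eventually_mono) (auto simp: indicator_def)
qed

context
  fixes X :: "'x set" and \<Sigma> :: "'x set set" and \<mu> :: "'x set \<Rightarrow> 'e::ordered_banach"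
    and A :: "'x set"
  assumes lat: "lattice_of_sets X \<Sigma>" and cap: "vector_capacity \<Sigma> \<mu>" and A: "A \<in> \<Sigma>"
begin

lemma antimono_level_capacity:
  assumes "CB_integrable X \<Sigma> \<mu> f"
  shows "antimono (\<lambda>t. \<mu> {x \<in> A. t \<le> f x})"
  by (intro antimonoI vector_capacityD(3)[OF cap] lattice_measurable_level[OF lat _ A]
      CB_integrableD(1)[OF assms]) auto

lemma CB_integral_mono:
  assumes f: "CB_integrable X \<Sigma> \<mu> f" and g: "CB_integrable X \<Sigma> \<mu> g"
    and le: "\<And>x. x \<in> A \<Longrightarrow> f x \<le> g x"
  shows "CB_integral \<mu> A f \<le> CB_integral \<mu> A g"
proof (rule has_strong_integral_mono[OF has_strong_integral_CB_integral[OF f A]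
      has_strong_integral_CB_integral[OF g A]])
  fix t :: real
  have "\<mu> {x \<in> A. t \<le> f x} \<le> \<mu> {x \<in> A. t \<le> g x}"
    using le
    by (intro vector_capacityD(3)[OF cap] lattice_measurable_level[OF lat _ A]
        CB_integrableD(1)[OF f] CB_integrableD(1)[OF g]) force
  then show "\<mu> {x \<in> A. t \<le> f x} - indicator {..0} t *\<^sub>R \<mu> A
    \<le> \<mu> {x \<in> A. t \<le> g x} - indicator {..0} t *\<^sub>R \<mu> A"
    by (rule diff_right_mono)
qed

text \<open>The integrand with the correction \<open>\<mu> A\<close> on the negative half-line
  converges under truncation but jumps up by \<open>\<mu> A\<close> at 0, so it need not be
  decreasing. The level function is decreasing and admits Riemann bounds. On the interval from
  \<open>b\<close> to \<open>c\<close> the two integrals differ by \<open>- b\<close> times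
  \<open>\<mu> A\<close>.\<close>

lemma truncated_CB_integral:
  assumes f: "CB_integrable X \<Sigma> \<mu> f" and "b \<le> 0" "0 \<le> c"
  shows "interval_integral (\<lambda>t. \<mu> {x \<in> A. t \<le> f x}) b c
    = interval_integral (\<lambda>t. \<mu> {x \<in> A. t \<le> f x} - indicator {..0} t *\<^sub>R \<mu> A) b c + (- b) *\<^sub>R \<mu> A"
proof (rule interval_integral_eq, rule has_strong_integral_cong_AE)
  have "locally_integrable (\<lambda>t. \<mu> {x \<in> A. t \<le> f x} - indicator {..0} t *\<^sub>R \<mu> A)"
    unfolding locally_integrable_def
    by (intro allI strongly_integrable_indicator
        has_strong_integral_imp_strongly_integrable[OF has_strong_integral_CB_integral[OF f A]]) auto
  moreover have "has_strong_integral lebesgue (\<lambda>t. indicator {b<..0} t *\<^sub>R \<mu> A) ((- b) *\<^sub>R \<mu> A)"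
    using has_strong_integral_interval_const[OF assms(2)] by simp
  ultimately show "has_strong_integral lebesgue
      (\<lambda>t. indicator {b<..c} t *\<^sub>R (\<mu> {x \<in> A. t \<le> f x} - indicator {..0} t *\<^sub>R \<mu> A)
        + indicator {b<..0} t *\<^sub>R \<mu> A)
      (interval_integral (\<lambda>t. \<mu> {x \<in> A. t \<le> f x} - indicator {..0} t *\<^sub>R \<mu> A) b c + (- b) *\<^sub>R \<mu> A)"
    by (intro has_strong_integral_add has_interval_integral)
  show "AE t in lebesgue. indicator {b<..c} t *\<^sub>R (\<mu> {x \<in> A. t \<le> f x} - indicator {..0} t *\<^sub>R \<mu> A)
      + indicator {b<..0} t *\<^sub>R \<mu> A = indicator {b<..c} t *\<^sub>R \<mu> {x \<in> A. t \<le> f x}"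
    using assms(3) by (intro AE_I2) (auto simp: indicator_def)
qed

lemma locally_integrable_level_capacity:
  assumes f: "CB_integrable X \<Sigma> \<mu> f"
  shows "locally_integrable (\<lambda>t. \<mu> {x \<in> A. t \<le> f x})"
  unfolding locally_integrable_def
proof (intro allI)
  fix b c :: real
  have "strongly_integrable lebesgue
      (\<lambda>t. indicator {b<..c} t *\<^sub>R (\<mu> {x \<in> A. t \<le> f x} - indicator {..0} t *\<^sub>R \<mu> A))"
    by (intro strongly_integrable_indicator
        has_strong_integral_imp_strongly_integrable[OF has_strong_integral_CB_integral[OF f A]]) auto
  then obtain v where v: "has_strong_integral lebesgue
      (\<lambda>t. indicator {b<..c} t *\<^sub>R (\<mu> {x \<in> A. t \<le> f x} - indicator {..0} t *\<^sub>R \<mu> A)) v"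
    unfolding strongly_integrable_def by blast
  \<comment> \<open>The correction lives on the part of the interval below 0, which ends at
    \<open>min c 0\<close>; the maximum with \<open>b\<close> makes it empty when no such part
    exists.\<close>
  have "b \<le> max b (min c 0)"
    by simp
  note w = has_strong_integral_interval_const[OF this, of "\<mu> A"]
  have "has_strong_integral lebesgue (\<lambda>t. indicator {b<..c} t *\<^sub>R \<mu> {x \<in> A. t \<le> f x})
    (v + (max b (min c 0) - b) *\<^sub>R \<mu> A)"
    by (rule has_strong_integral_cong_AE[OF has_strong_integral_add[OF v w]])
      (auto simp: indicator_def intro!: AE_I2)
  then show "strongly_integrable lebesgue (\<lambda>t. indicator {b<..c} t *\<^sub>R \<mu> {x \<in> A. t \<le> f x})"
    by (rule has_strong_integral_imp_strongly_integrable)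
qed

lemma CB_integral_truncation_tendsto:
  assumes f: "CB_integrable X \<Sigma> \<mu> f"
    and b: "filterlim b at_bot sequentially" and c: "filterlim c at_top sequentially"
  shows "(\<lambda>p. interval_integral (\<lambda>t. \<mu> {x \<in> A. t \<le> f x} - indicator {..0} t *\<^sub>R \<mu> A) (b p) (c p))
    \<longlonglongrightarrow> CB_integral \<mu> A f"
  unfolding interval_integral_def
proof (rule tendsto_strong_integral_indicator[OF has_strong_integral_CB_integral[OF f A]])
  show "\<forall>\<^sub>F p in sequentially. t \<in> {b p<..c p}" for t
  proof -
    have "\<forall>\<^sub>F p in sequentially. b p < t" "\<forall>\<^sub>F p in sequentially. t \<le> c p"
      using b c by (auto simp: filterlim_at_bot_dense filterlim_at_top)
    then show ?thesis
      by eventually_elim simp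
  qed
qed simp

text \<open>Left endpoints bound the integral for f + g from above, right endpoints those for f and
  g from below. All comparisons point the same way, so no Riemann sum has to be shown convergent,
  and the only error is the shift by \<open>2 * h\<close> of the levels of f + g.\<close>

lemma CB_integral_subadditive:
  assumes sub: "submodular \<Sigma> \<mu>"
    and f: "CB_integrable X \<Sigma> \<mu> f" and g: "CB_integrable X \<Sigma> \<mu> g"
    and fg: "CB_integrable X \<Sigma> \<mu> (\<lambda>x. f x + g x)"
  shows "CB_integral \<mu> A (\<lambda>x. f x + g x) \<le> CB_integral \<mu> A f + CB_integral \<mu> A g"
proof -
  let ?F = "\<lambda>f t. \<mu> {x \<in> A. t \<le> f x}"
  let ?T = "\<lambda>f. interval_integral (\<lambda>t. ?F f t - indicator {..0} t *\<^sub>R \<mu> A)"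
  let ?fg = "\<lambda>x. f x + g x"
  let ?p = "\<lambda>p::nat. 1 + real p"
  let ?h = "\<lambda>p. inverse (?p p)"
  have le: "?T ?fg (2 * ?h p - 2 * ?p p) (2 * ?h p + 2 * ?p p)
    \<le> ?T f (- ?p p) (3 * ?p p) + ?T g (- ?p p) (3 * ?p p) + (2 * ?h p) *\<^sub>R \<mu> A" for p
  proof -
    \<comment> \<open>With mesh \<open>1 / (1 + p)\<close> and \<open>n\<close> the square of
      \<open>1 + p\<close>, the half-width \<open>n * h\<close> is \<open>1 + p\<close>: a single
      limit refines the mesh and exhausts the line.\<close>
    define n where "n = Suc p * Suc p"
    let ?b = "(2 - 2 * real n) * ?h p" and ?d = "- real n * ?h p"
    have h: "0 < ?h p"
      by simp
    have n: "real n * ?h p = ?p p"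
    proof -
      have "real n = ?p p * ?p p"
        by (simp only: n_def of_nat_mult of_nat_Suc)
      then show ?thesis
        by (simp only: mult.assoc) (simp add: add_nonneg_eq_0_iff)
    qed
    have b: "?b = 2 * ?h p - 2 * ?p p" and e: "?b + real (4 * n) * ?h p = 2 * ?h p + 2 * ?p p"
      and d: "?d = - ?p p" "- ?p p + real (4 * n) * ?h p = 3 * ?p p"
      using n by (simp_all add: algebra_simps)
    \<comment> \<open>As \<open>h\<close> is at most 1 and \<open>1 + p\<close> at least 1, the left
      end of the interval for f + g is nonpositive, as \<open>truncated_CB_integral\<close>
      requires.\<close>
    have "?h p \<le> 1"
      by (simp add: inverse_le_1_iff)
    then have b0: "2 * ?h p - 2 * ?p p \<le> 0"
      by simp
    note riemann = interval_integral_riemann_bounds[OF locally_integrable_level_capacity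
        antimono_level_capacity less_imp_le[OF h]]
    have "interval_integral (?F ?fg) ?b (?b + real (4 * n) * ?h p)
      \<le> ?h p *\<^sub>R (\<Sum>i<4 * n. ?F ?fg (?b + real i * ?h p))"
      using riemann[OF fg fg] by blast
    also have "\<dots> \<le> ?h p *\<^sub>R ((\<Sum>i<4 * n. ?F f (?d + real (Suc i) * ?h p))
        + (\<Sum>i<4 * n. ?F g (?d + real (Suc i) * ?h p)))"
      using sum_real_level_sets_add[OF lat cap sub A CB_integrableD(1)[OF f]
          CB_integrableD(1)[OF g] CB_integrableD(1)[OF fg] h]
      by (rule scaleR_left_mono) (rule less_imp_le[OF h])
    also have "\<dots> \<le> interval_integral (?F f) ?d (?d + real (4 * n) * ?h p)
        + interval_integral (?F g) ?d (?d + real (4 * n) * ?h p)"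
      unfolding scaleR_add_right using riemann[OF f f] riemann[OF g g] by (intro add_mono) blast+
    finally have "interval_integral (?F ?fg) (2 * ?h p - 2 * ?p p) (2 * ?h p + 2 * ?p p)
      \<le> interval_integral (?F f) (- ?p p) (3 * ?p p) + interval_integral (?F g) (- ?p p) (3 * ?p p)"
      unfolding e unfolding b d(1) unfolding d(2) .
    moreover have "interval_integral (?F ?fg) (2 * ?h p - 2 * ?p p) (2 * ?h p + 2 * ?p p)
      = ?T ?fg (2 * ?h p - 2 * ?p p) (2 * ?h p + 2 * ?p p) + (- (2 * ?h p - 2 * ?p p)) *\<^sub>R \<mu> A"
      by (rule truncated_CB_integral[OF fg b0]) simp
    moreover have "interval_integral (?F f) (- ?p p) (3 * ?p p) = ?T f (- ?p p) (3 * ?p p) + (- (- ?p p)) *\<^sub>R \<mu> A"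
      by (rule truncated_CB_integral[OF f]) simp_all
    moreover have "interval_integral (?F g) (- ?p p) (3 * ?p p) = ?T g (- ?p p) (3 * ?p p) + (- (- ?p p)) *\<^sub>R \<mu> A"
      by (rule truncated_CB_integral[OF g]) simp_all
    ultimately have "?T ?fg (2 * ?h p - 2 * ?p p) (2 * ?h p + 2 * ?p p) + (- (2 * ?h p - 2 * ?p p)) *\<^sub>R \<mu> A
      \<le> (?T f (- ?p p) (3 * ?p p) + (- (- ?p p)) *\<^sub>R \<mu> A) + (?T g (- ?p p) (3 * ?p p) + (- (- ?p p)) *\<^sub>R \<mu> A)"
      by simp
    \<comment> \<open>The corrections of f and g contribute \<open>2 * (1 + p)\<close> copies of
      \<open>\<mu> A\<close>, that of f + g only \<open>2 * (1 + p) - 2 * h\<close>. The unbounded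
      parts cancel and \<open>2 * h\<close> remains.\<close>
    also have "\<dots> = (?T f (- ?p p) (3 * ?p p) + ?T g (- ?p p) (3 * ?p p) + (2 * ?h p) *\<^sub>R \<mu> A)
        + (- (2 * ?h p - 2 * ?p p)) *\<^sub>R \<mu> A"
      by (simp add: algebra_simps flip: scaleR_add_left)
    finally show ?thesis
      by (simp only: add_le_cancel_right)
  qed
  have h: "?h \<longlonglongrightarrow> 0"
    by real_asymp
  have "(\<lambda>p. ?T f (- ?p p) (3 * ?p p) + ?T g (- ?p p) (3 * ?p p) + (2 * ?h p) *\<^sub>R \<mu> A
      - ?T ?fg (2 * ?h p - 2 * ?p p) (2 * ?h p + 2 * ?p p))
    \<longlonglongrightarrow> CB_integral \<mu> A f + CB_integral \<mu> A g + (2 * 0) *\<^sub>R \<mu> A - CB_integral \<mu> A ?fg"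
    by (intro tendsto_intros h CB_integral_truncation_tendsto f g fg; real_asymp)
  then have "CB_integral \<mu> A f + CB_integral \<mu> A g + (2 * 0) *\<^sub>R \<mu> A - CB_integral \<mu> A ?fg \<in> {x. 0 \<le> x}"
    by (rule closed_sequentially[OF closed_positive_cone, rotated]) (use le in simp)
  then show ?thesis
    by simp
qed

end


section \<open>The modulus inequality\<close>

text \<open>Diminishing returns: joining a set \<open>S\<close> to both members of a nested pair can
  only shrink the gap between their capacities. The passage from \<open>P' \<union> Q'\<close> to
  \<open>P \<union> Q\<close> is split at \<open>P' \<union> Q\<close> so that one set changes at a
  time.\<close>

lemma submodular_Un_diff_le:
  fixes \<mu> :: "'x set \<Rightarrow> 'e::ordered_banach"
  assumes lat: "lattice_of_sets X \<Sigma>" and cap: "vector_capacity \<Sigma> \<mu>" and sub: "submodular \<Sigma> \<mu>"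
    and P: "P \<in> \<Sigma>" "P' \<in> \<Sigma>" "P' \<subseteq> P" and Q: "Q \<in> \<Sigma>" "Q' \<in> \<Sigma>" "Q' \<subseteq> Q"
  shows "\<mu> (P \<union> Q) - \<mu> (P' \<union> Q') \<le> (\<mu> P + \<mu> Q) - (\<mu> P' + \<mu> Q')"
proof -
  have step: "\<mu> (R \<union> S) - \<mu> (R' \<union> S) \<le> \<mu> R - \<mu> R'"
    if "R \<in> \<Sigma>" "R' \<in> \<Sigma>" "S \<in> \<Sigma>" "R' \<subseteq> R" for R R' S
  proof -
    have "R' \<union> S \<in> \<Sigma>"
      using that by (intro lattice_of_setsD[OF lat])
    \<comment> \<open>Submodularity is applied to \<open>R\<close> and \<open>R' \<union> S\<close>,
      whose intersection contains \<open>R'\<close>; monotonicity then replaces that intersection by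
      \<open>R'\<close>.\<close>
    then have "\<mu> (R \<union> (R' \<union> S)) + \<mu> (R \<inter> (R' \<union> S)) \<le> \<mu> R + \<mu> (R' \<union> S)"
      using that by (intro submodularD[OF sub])
    moreover have "R \<union> (R' \<union> S) = R \<union> S"
      using that by blast
    moreover have "\<mu> R' \<le> \<mu> (R \<inter> (R' \<union> S))"
      using that \<open>R' \<union> S \<in> \<Sigma>\<close>
      by (intro vector_capacityD(3)[OF cap] lattice_of_setsD(2)[OF lat]) auto
    ultimately have "\<mu> (R \<union> S) + \<mu> R' \<le> \<mu> R + \<mu> (R' \<union> S)"
      by (metis add_left_mono order_trans)
    then show ?thesis
      by (simp add: algebra_simps)
  qed
  have "(\<mu> (P \<union> Q) - \<mu> (P' \<union> Q)) + (\<mu> (Q \<union> P') - \<mu> (Q' \<union> P')) \<le> (\<mu> P - \<mu> P') + (\<mu> Q - \<mu> Q')"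
    using P Q by (intro add_mono step)
  then show ?thesis
    by (simp add: algebra_simps Un_commute)
qed

text \<open>For the absolute value the level sets are unions of those of f and - f, so increments
  are compared by \<open>submodular_Un_diff_le\<close>. They are nonnegative for ordered arguments,
  and norm monotonicity yields the hypotheses of
  \<open>strongly_integrable_dominated\<close>.\<close>

lemma CB_integrable_abs:
  fixes \<mu> :: "'x set \<Rightarrow> 'e::ordered_banach"
  assumes lat: "lattice_of_sets X \<Sigma>" and cap: "vector_capacity \<Sigma> \<mu>" and sub: "submodular \<Sigma> \<mu>"
    and f: "CB_integrable X \<Sigma> \<mu> f" and f': "CB_integrable X \<Sigma> \<mu> (\<lambda>x. - f x)"
  shows "CB_integrable X \<Sigma> \<mu> (\<lambda>x. \<bar>f x\<bar>)"
proof -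
  have Un: "{x \<in> A. t \<le> \<bar>f x\<bar>} = {x \<in> A. t \<le> f x} \<union> {x \<in> A. t \<le> - f x}" for A t
    by auto
  have lev: "{x \<in> A. t \<le> f x} \<in> \<Sigma>" "{x \<in> A. t \<le> - f x} \<in> \<Sigma>" if "A \<in> \<Sigma>" for A t
    using that lattice_measurable_level[OF lat] CB_integrableD(1)[OF f] CB_integrableD(1)[OF f'] by blast+
  have "X \<in> \<Sigma>"
    using lat by (simp add: lattice_of_sets_def)
  then have "lattice_measurable X \<Sigma> (\<lambda>x. \<bar>f x\<bar>)"
    unfolding lattice_measurable_def Un by (intro allI lattice_of_setsD[OF lat] lev)
  moreover have "strongly_integrable (lebesgue_on {0..}) (\<lambda>t. \<mu> {x \<in> A. t \<le> \<bar>f x\<bar>})" if A: "A \<in> \<Sigma>" for A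
  proof -
    let ?H = "\<lambda>t. \<mu> {x \<in> A. t \<le> f x} + \<mu> {x \<in> A. t \<le> - f x}" and ?K = "\<lambda>t. \<mu> {x \<in> A. t \<le> \<bar>f x\<bar>}"
    note lev = lev[OF A]
    have K: "{x \<in> A. t \<le> \<bar>f x\<bar>} \<in> \<Sigma>" for t
      unfolding Un by (intro lattice_of_setsD[OF lat] lev)
    have "strongly_integrable (lebesgue_on {0..}) ?H"
      by (rule has_strong_integral_imp_strongly_integrable[OF has_strong_integral_add[OF
            has_strong_integral_strong_integral[OF CB_integrableD(2)[OF f A]]
            has_strong_integral_strong_integral[OF CB_integrableD(2)[OF f' A]]]])
    moreover have "norm (?K t) \<le> norm (?H t)" for t
    proof (rule norm_mono_positive)
      have le: "\<mu> ({x \<in> A. t \<le> f x} \<union> {x \<in> A. t \<le> - f x}) + \<mu> ({x \<in> A. t \<le> f x} \<inter> {x \<in> A. t \<le> - f x}) \<le> ?H t"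
        by (intro submodularD[OF sub] lev)
      have "0 \<le> \<mu> ({x \<in> A. t \<le> f x} \<inter> {x \<in> A. t \<le> - f x})"
        by (intro vector_capacityD(1)[OF cap] lattice_of_setsD[OF lat] lev)
      then show "?K t \<le> ?H t"
        unfolding Un by (intro order_trans[OF _ le]) simp
    qed (intro vector_capacityD(1)[OF cap] K)
    moreover have "norm (?K s - ?K t) \<le> norm (?H s - ?H t)" for s t
    proof (induction s t rule: linorder_wlog)
      case (le s t)
      have sub1: "{x \<in> A. t \<le> f x} \<subseteq> {x \<in> A. s \<le> f x}" and sub2: "{x \<in> A. t \<le> - f x} \<subseteq> {x \<in> A. s \<le> - f x}"
        and sub3: "{x \<in> A. t \<le> \<bar>f x\<bar>} \<subseteq> {x \<in> A. s \<le> \<bar>f x\<bar>}"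
        using le by auto
      show ?case
      proof (rule norm_mono_positive)
        show "0 \<le> ?K s - ?K t"
          using vector_capacityD(3)[OF cap K K sub3] by simp
        show "?K s - ?K t \<le> ?H s - ?H t"
          unfolding Un by (intro submodular_Un_diff_le[OF lat cap sub] lev sub1 sub2)
      qed
    next
      case (sym s t)
      then show ?case
        by (simp add: norm_minus_commute)
    qed
    ultimately show ?thesis
      by (rule strongly_integrable_dominated) (rule has_strong_integral_imp_strongly_integrable)
  qed
  moreover have "strongly_integrable (lebesgue_on {..0}) (\<lambda>t. \<mu> {x \<in> A. t \<le> \<bar>f x\<bar>} - \<mu> A)" for A
  proof -
    \<comment> \<open>For nonpositive levels the level set is all of \<open>A\<close>, so the
      integrand vanishes; the zero function is written as an empty indicator to have its integral at
      hand.\<close>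
    have "has_strong_integral (lebesgue_on {..0 :: real}) (\<lambda>t. indicator {} t *\<^sub>R \<mu> A)
      (measure (lebesgue_on {..0 :: real}) {} *\<^sub>R \<mu> A)"
      by (rule has_strong_integral_indicator) auto
    moreover have "AE t in lebesgue_on {..0}. indicator {} t *\<^sub>R \<mu> A = \<mu> {x \<in> A. t \<le> \<bar>f x\<bar>} - \<mu> A"
    proof (rule AE_I2)
      fix t :: real assume "t \<in> space (lebesgue_on {..0})"
      then have "t \<le> \<bar>f x\<bar>" for x
        by (simp add: space_restrict_space order_trans[OF _ abs_ge_zero])
      then show "indicator {} t *\<^sub>R \<mu> A = \<mu> {x \<in> A. t \<le> \<bar>f x\<bar>} - \<mu> A"
        by simp
    qed
    ultimately show ?thesis
      by (intro has_strong_integral_imp_strongly_integrable[OF has_strong_integral_cong_AE])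
  qed
  ultimately show ?thesis
    unfolding CB_integrable_def by blast
qed

text \<open>This allows the bound for the modulus of a single integral to be obtained as the case g
  = 0 of the bound for a difference.\<close>

lemma CB_zero:
  fixes \<mu> :: "'x set \<Rightarrow> 'e::ordered_banach"
  assumes lat: "lattice_of_sets X \<Sigma>" and cap: "vector_capacity \<Sigma> \<mu>"
  shows "CB_integrable X \<Sigma> \<mu> (\<lambda>_. 0)" and "CB_integral \<mu> A (\<lambda>_. 0) = 0"
proof -
  have zero: "has_strong_integral (lebesgue_on S) f 0"
    if "\<And>t. t \<in> S \<Longrightarrow> t \<noteq> 0 \<Longrightarrow> f t = 0" "S \<in> sets lebesgue" for S :: "real set" and f :: "real \<Rightarrow> 'e"
  proof (rule has_strong_integral_cong_AE)
    show "has_strong_integral (lebesgue_on S) (\<lambda>t. indicator {} t *\<^sub>R (0 :: 'e)) 0"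
      using has_strong_integral_indicator[of "{}" "lebesgue_on S" "0 :: 'e"] by simp
    \<comment> \<open>At t = 0 the level set of the zero function is still \<open>A\<close>, so on
      the nonnegative half-line the integrand is 0 only off this point.\<close>
    have "AE t in lebesgue. t \<noteq> (0 :: real)"
      by (rule AE_I'[of "{0}"]) auto
    then have "AE t in lebesgue. t \<in> S \<longrightarrow> t \<noteq> 0"
      by (rule eventually_mono) simp
    then have "AE t in lebesgue_on S. t \<noteq> 0"
      using that(2) by (subst AE_restrict_space_iff) auto
    then show "AE t in lebesgue_on S. indicator {} t *\<^sub>R (0 :: 'e) = f t"
      using AE_space
    proof eventually_elim
      case (elim t)
      then have "f t = 0"
        by (intro that(1)) (simp_all add: space_restrict_space)
      then show ?case
        by simp
    qed
  qed
  have I: "has_strong_integral (lebesgue_on {0 :: real..}) (\<lambda>t. \<mu> {x \<in> A. t \<le> 0}) 0"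
    "has_strong_integral (lebesgue_on {..0 :: real}) (\<lambda>t. \<mu> {x \<in> A. t \<le> 0} - \<mu> A) 0" for A :: "'x set"
    by (rule zero; auto simp: vector_capacityD(2)[OF cap])+
  have "lattice_measurable X \<Sigma> (\<lambda>_. 0)"
    unfolding lattice_measurable_def
  proof
    fix t :: real
    have "{x \<in> X. t \<le> 0} = (if t \<le> 0 then X else {})"
      by auto
    then show "{x \<in> X. t \<le> 0} \<in> \<Sigma>"
      using lat unfolding lattice_of_sets_def by simp
  qed
  then show "CB_integrable X \<Sigma> \<mu> (\<lambda>_. 0)"
    unfolding CB_integrable_def by (intro conjI ballI has_strong_integral_imp_strongly_integrable[OF I(1)] has_strong_integral_imp_strongly_integrable[OF I(2)])
  show "CB_integral \<mu> A (\<lambda>_. 0) = 0"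
    unfolding CB_integral_def strong_integral_eq[OF I(1)] strong_integral_eq[OF I(2)] by simp
qed

lemma modulus_le:
  fixes x u :: "'e::{banach, ordered_real_vector}"
  assumes "banach_lattice TYPE('e)" "x \<le> u" "- x \<le> u"
  shows "modulus x \<le> u"
proof -
  obtain s where s: "x \<le> s" "- x \<le> s" "\<And>u. x \<le> u \<Longrightarrow> - x \<le> u \<Longrightarrow> s \<le> u"
    using assms(1) unfolding banach_lattice_def vector_lattice_def by metis
  have "modulus x = s"
    unfolding modulus_def by (rule Least_equality) (use s in auto)
  with s(3)[OF assms(2,3)] show ?thesis
    by simp
qed

text \<open>Subadditivity for the decomposition f = (f - g) + g gives the integral of f - g as a
  bound; monotonicity then passes to the absolute value. Exchanging f and g bounds the negative, and
  the two bounds together control the modulus.\<close>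

lemma CB_integral_diff_le:
  fixes \<mu> :: "'x set \<Rightarrow> 'e::ordered_banach"
  assumes lat: "lattice_of_sets X \<Sigma>" and cap: "vector_capacity \<Sigma> \<mu>" and sub: "submodular \<Sigma> \<mu>"
    and A: "A \<in> \<Sigma>" and f: "CB_integrable X \<Sigma> \<mu> f" and g: "CB_integrable X \<Sigma> \<mu> g"
    and fg: "CB_integrable X \<Sigma> \<mu> (\<lambda>x. f x - g x)"
    and abs: "CB_integrable X \<Sigma> \<mu> (\<lambda>x. \<bar>f x - g x\<bar>)"
  shows "CB_integral \<mu> A f - CB_integral \<mu> A g \<le> CB_integral \<mu> A (\<lambda>x. \<bar>f x - g x\<bar>)"
proof -
  have "CB_integral \<mu> A f \<le> CB_integral \<mu> A (\<lambda>x. f x - g x) + CB_integral \<mu> A g"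
    using CB_integral_subadditive[OF lat cap A sub fg g] f by simp
  also have "CB_integral \<mu> A (\<lambda>x. f x - g x) \<le> CB_integral \<mu> A (\<lambda>x. \<bar>f x - g x\<bar>)"
    by (rule CB_integral_mono[OF lat cap A fg abs]) simp
  finally show ?thesis
    by (simp add: diff_le_eq)
qed

lemma modulus_CB_integral_diff_le:
  fixes \<mu> :: "'x set \<Rightarrow> 'e::ordered_banach"
  assumes lat: "lattice_of_sets X \<Sigma>" and cap: "vector_capacity \<Sigma> \<mu>" and sub: "submodular \<Sigma> \<mu>"
    and bl: "banach_lattice TYPE('e)"
    and f: "CB_integrable X \<Sigma> \<mu> f" and g: "CB_integrable X \<Sigma> \<mu> g"
    and fg: "CB_integrable X \<Sigma> \<mu> (\<lambda>x. f x - g x)" and gf: "CB_integrable X \<Sigma> \<mu> (\<lambda>x. g x - f x)"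
  shows "CB_integrable X \<Sigma> \<mu> (\<lambda>x. \<bar>f x - g x\<bar>)"
    and "A \<in> \<Sigma> \<Longrightarrow> modulus (CB_integral \<mu> A f - CB_integral \<mu> A g) \<le> CB_integral \<mu> A (\<lambda>x. \<bar>f x - g x\<bar>)"
proof -
  show abs: "CB_integrable X \<Sigma> \<mu> (\<lambda>x. \<bar>f x - g x\<bar>)"
    using CB_integrable_abs[OF lat cap sub fg] gf by simp
  show "modulus (CB_integral \<mu> A f - CB_integral \<mu> A g) \<le> CB_integral \<mu> A (\<lambda>x. \<bar>f x - g x\<bar>)"
    if A: "A \<in> \<Sigma>"
  proof (rule modulus_le[OF bl])
    show "CB_integral \<mu> A f - CB_integral \<mu> A g \<le> CB_integral \<mu> A (\<lambda>x. \<bar>f x - g x\<bar>)"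
      by (rule CB_integral_diff_le[OF lat cap sub A f g fg abs])
    have "CB_integral \<mu> A g - CB_integral \<mu> A f \<le> CB_integral \<mu> A (\<lambda>x. \<bar>f x - g x\<bar>)"
      using CB_integral_diff_le[OF lat cap sub A g f gf] abs by (simp add: abs_minus_commute)
    then show "- (CB_integral \<mu> A f - CB_integral \<mu> A g) \<le> CB_integral \<mu> A (\<lambda>x. \<bar>f x - g x\<bar>)"
      by simp
  qed
qed

theorem theorem2:
  fixes X :: "'x set" and \<Sigma> :: "'x set set"
    and \<mu> :: "'x set \<Rightarrow> 'e::regularly_ordered_banach"
  assumes "X \<noteq> {}"
    and "lattice_of_sets X \<Sigma>"
    and "vector_capacity \<Sigma> \<mu>"
    and "submodular \<Sigma> \<mu>"
  shows "(\<forall>f g. CB_integrable X \<Sigma> \<mu> f \<and> CB_integrable X \<Sigma> \<mu> g \<and>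
            CB_integrable X \<Sigma> \<mu> (\<lambda>x. f x + g x) \<longrightarrow>
            (\<forall>A\<in>\<Sigma>. CB_integral \<mu> A (\<lambda>x. f x + g x) \<le> CB_integral \<mu> A f + CB_integral \<mu> A g)) \<and>
         (banach_lattice TYPE('e) \<longrightarrow>
           (\<forall>f g. CB_integrable X \<Sigma> \<mu> f \<and> CB_integrable X \<Sigma> \<mu> g \<and>
              CB_integrable X \<Sigma> \<mu> (\<lambda>x. f x - g x) \<and> CB_integrable X \<Sigma> \<mu> (\<lambda>x. g x - f x) \<longrightarrow>
              CB_integrable X \<Sigma> \<mu> (\<lambda>x. \<bar>f x - g x\<bar>) \<and>
              (\<forall>A\<in>\<Sigma>. modulus (CB_integral \<mu> A f - CB_integral \<mu> A g)
                 \<le> CB_integral \<mu> A (\<lambda>x. \<bar>f x - g x\<bar>))) \<and>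
           (\<forall>f. CB_integrable X \<Sigma> \<mu> f \<and> CB_integrable X \<Sigma> \<mu> (\<lambda>x. - f x) \<longrightarrow>
              CB_integrable X \<Sigma> \<mu> (\<lambda>x. \<bar>f x\<bar>) \<and>
              (\<forall>A\<in>\<Sigma>. modulus (CB_integral \<mu> A f) \<le> CB_integral \<mu> A (\<lambda>x. \<bar>f x\<bar>))))"
proof (intro conjI impI allI; (elim conjE)?)
  note lat = assms(2) and cap = assms(3) and sub = assms(4)
  show "\<forall>A\<in>\<Sigma>. CB_integral \<mu> A (\<lambda>x. f x + g x) \<le> CB_integral \<mu> A f + CB_integral \<mu> A g"
    if "CB_integrable X \<Sigma> \<mu> f" "CB_integrable X \<Sigma> \<mu> g" "CB_integrable X \<Sigma> \<mu> (\<lambda>x. f x + g x)" for f g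
    using CB_integral_subadditive[OF lat cap _ sub that] by blast
  assume bl: "banach_lattice TYPE('e)"
  show "CB_integrable X \<Sigma> \<mu> (\<lambda>x. \<bar>f x - g x\<bar>)"
    "\<forall>A\<in>\<Sigma>. modulus (CB_integral \<mu> A f - CB_integral \<mu> A g) \<le> CB_integral \<mu> A (\<lambda>x. \<bar>f x - g x\<bar>)"
    if "CB_integrable X \<Sigma> \<mu> f" "CB_integrable X \<Sigma> \<mu> g"
      "CB_integrable X \<Sigma> \<mu> (\<lambda>x. f x - g x)" "CB_integrable X \<Sigma> \<mu> (\<lambda>x. g x - f x)" for f g
    using modulus_CB_integral_diff_le[OF lat cap sub bl that] by blast+
  show "CB_integrable X \<Sigma> \<mu> (\<lambda>x. \<bar>f x\<bar>)"
    "\<forall>A\<in>\<Sigma>. modulus (CB_integral \<mu> A f) \<le> CB_integral \<mu> A (\<lambda>x. \<bar>f x\<bar>)"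
    if "CB_integrable X \<Sigma> \<mu> f" "CB_integrable X \<Sigma> \<mu> (\<lambda>x. - f x)" for f
    \<comment> \<open>Here g is the zero function, whose integral vanishes; f - 0 and 0 - f simplify
      to f and - f.\<close>
    using modulus_CB_integral_diff_le[OF lat cap sub bl that(1) CB_zero(1)[OF lat cap]] that
    by (simp_all add: CB_zero(2)[OF lat cap])
qed

end
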